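(* There exists an absolute constant $C>0$ such that the following holds. For every integer $n\ge 2$, every positive integer $m$, all monotone utility functions $u_1,\dots,u_n:\{0,1\}^m\to\mathbb{R}$ of $n$ agents on the set of goods $[m]$, and every partition of the set of agents $\{1,\dots,n\}$ into two groups (group $1$ and group $2$), there exist a non-negative integer $c\le C\sqrt{n\log n}$ and an allocation $(A_1,A_2)$ of the goods $[m]$ to the two groups that is envy-free up to $c$ goods.
   Context: Write $[m]=\{1,\dots,m\}$. A subset $S\subseteq[m]$ is identified with its indicator vector in $\{0,1\}^m$, so a function $u:\{0,1\}^m\to\mathbb{R}$ is a real-valued set function on subsets of $[m]$. It is monotone if $u(S)\le u(S')$ whenever $S\subseteq S'\subseteq[m]$; utilities are not assumed to be additive. The agents are partitioned into two groups arbitrarily. An allocation $(A_1,A_2)$ consists of disjoint (possibly empty) sets with $A_1\cup A_2=[m]$, where $A_j$ is allocated to group $j$ for $j\in\{1,2\}$. It is envy-free up to $c$ goods if for each $j\in\{1,2\}$ and each agent $i$ in group $j$, there exists $R_{3-j}\subseteq A_{3-j}$ (which may depend on $i$) with $|R_{3-j}|\le c$ such that $u_i(A_j)\ge u_i(A_{3-j}\setminus R_{3-j})$. *)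

theory Defs
  imports Complex_Main
begin

text \<open>Goods and agents are natural numbers: the goods are \<open>{1..m}\<close>, the agents \<open>{1..n}\<close>.
  A set function on subsets of \<open>{1..m}\<close> is a function on \<open>nat set\<close> of which only the
  values on \<open>Pow {1..m}\<close> are relevant.\<close>

definition allocation :: "nat \<Rightarrow> nat set \<Rightarrow> nat set \<Rightarrow> bool" where
  "allocation m A\<^sub>1 A\<^sub>2 \<longleftrightarrow> A\<^sub>1 \<union> A\<^sub>2 = {1..m} \<and> A\<^sub>1 \<inter> A\<^sub>2 = {}"

text \<open>An agent with utility function \<open>v\<close> whose group receives \<open>A\<close> while the other group
  receives \<open>B\<close> does not envy after the removal of at most \<open>c\<close> goods from \<open>B\<close>. Finiteness
  is required because the cardinality of an infinite set is \<open>0\<close>.\<close>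

definition no_envy_up_to :: "nat \<Rightarrow> (nat set \<Rightarrow> real) \<Rightarrow> nat set \<Rightarrow> nat set \<Rightarrow> bool" where
  "no_envy_up_to c v A B \<longleftrightarrow> (\<exists>R. R \<subseteq> B \<and> finite R \<and> card R \<le> c \<and> v A \<ge> v (B - R))"

definition envy_free_up_to ::
  "nat \<Rightarrow> (nat \<Rightarrow> nat set \<Rightarrow> real) \<Rightarrow> nat set \<Rightarrow> nat set \<Rightarrow> nat set \<Rightarrow> nat set \<Rightarrow> bool" where
  "envy_free_up_to c u G\<^sub>1 G\<^sub>2 A\<^sub>1 A\<^sub>2 \<longleftrightarrow>
     (\<forall>i\<in>G\<^sub>1. no_envy_up_to c (u i) A\<^sub>1 A\<^sub>2) \<and> (\<forall>i\<in>G\<^sub>2. no_envy_up_to c (u i) A\<^sub>2 A\<^sub>1)"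

end

theory Submission
  imports Defs "HOL-Homology.Invariance_of_Domain"
begin

text \<open>The difference \<open>v S - v (M - S)\<close> is replaced by a function that is odd under complementation and
  changes by at most 2 when one good moves: a clipped Hamming distance to the set of bundles that are
  envied beyond \<open>c\<close> goods, minus the same for the complement. So it is enough to bound the discrepancy
  of \<open>n\<close> odd Lipschitz set functions by \<open>O(\<surd>(n ln n))\<close>. By the Borsuk--Ulam theorem, applied to the divisions
  of an interval by \<open>n\<close> cuts, their multilinear extensions have a common zero with at most \<open>n\<close> fractional
  coordinates, and rounding these changes the values by \<open>O(\<surd>(n ln n))\<close> only. Borsuk--Ulam itself follows
  from the mod 2 comparison of the degree of an odd map with that of its restriction to the equator.\<close>

subsection \<open>Lipschitz functions on the sphere\<close>

text \<open>A monotone utility has no scale: moving one good may change it arbitrarily, and only the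
  order between bundles matters. The replacement is itself built from \<open>c\<close>, yet this is
  not circular: its Lipschitz constant does not depend on \<open>c\<close>, so the discrepancy bound
  depends on \<open>n\<close> alone and \<open>c\<close> can be taken just above it. Oddness serves
  twice: Borsuk-Ulam needs it, and it makes a small absolute value satisfy an agent on either side
  of the division. Two counts of \<open>n\<close> meet. The \<open>n\<close> cuts give
  \<open>n + 1\<close> signed lengths, that is a point of the sphere of dimension \<open>n\<close>,
  just enough to annihilate \<open>n\<close> functions; and since at most \<open>n\<close> goods are
  cut, rounding deviates by the order of \<open>sqrt n\<close>, with a factor
  \<open>sqrt (ln n)\<close> for controlling all functions together. The obstacle in the degree
  argument is that the image of the equator must miss a direction, which can fail for merely
  continuous maps because of space-filling images.\<close>

definition sph :: "nat \<Rightarrow> (nat \<Rightarrow> real) set" where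
  "sph n = {x. (\<Sum>i\<le>n. (x i)\<^sup>2) = 1 \<and> (\<forall>i>n. x i = 0)}"

lemma sph_iff: "x \<in> sph n \<longleftrightarrow> (\<Sum>i\<le>n. (x i)\<^sup>2) = 1 \<and> (\<forall>i>n. x i = 0)"
  by (simp add: sph_def)

lemma nsphere_top_of_set: "nsphere n = top_of_set (sph n)"
  by (simp add: nsphere euclidean_product_topology sph_def)

lemma topspace_nsphere: "topspace (nsphere n) = sph n"
  by (simp add: nsphere_top_of_set)

lemma sph_abs_le_1: "x \<in> sph n \<Longrightarrow> \<bar>x k\<bar> \<le> 1"
  using topspace_nsphere_1[of x n k] unfolding topspace_nsphere
  by (simp add: abs_square_le_1)

lemma sph_uminus: "x \<in> sph n \<Longrightarrow> (\<lambda>i. - x i) \<in> sph n"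
  by (simp add: sph_iff)

lemma sph_mono: "m \<le> n \<Longrightarrow> sph m \<subseteq> sph n"
proof
  fix x assume "m \<le> n" and x: "x \<in> sph m"
  have "(\<Sum>i\<le>n. (x i)\<^sup>2) = (\<Sum>i\<le>m. (x i)\<^sup>2)"
    by (rule sum.mono_neutral_right) (use x \<open>m \<le> n\<close> in \<open>auto simp: sph_iff\<close>)
  with x \<open>m \<le> n\<close> show "x \<in> sph n" by (auto simp: sph_iff)
qed

lemma L2_set_sph: "x \<in> sph n \<Longrightarrow> L2_set x {..n} = 1"
  by (simp add: L2_set_def sph_iff)

text \<open>Points are infinite sequences here, so compactness comes from Tychonoff's theorem for a
  power of \<open>{-1..1}\<close>.\<close>

lemma compact_sph: "compact (sph n)"
proof -
  have "compactin (product_topology (\<lambda>i. euclidean) UNIV) (PiE UNIV (\<lambda>i::nat. {-1..1::real}))"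
    by (subst compactin_PiE) auto
  then have "compact (PiE UNIV (\<lambda>i::nat. {-1..1::real}))"
    by (simp add: euclidean_product_topology)
  moreover have "closed (sph n)"
  proof -
    have "sph n = {x. (\<Sum>i\<le>n. (x i)\<^sup>2) = 1} \<inter> (\<Inter>i\<in>{n<..}. {x. x i = 0})" by (auto simp: sph_def)
    moreover have "closed {x::nat\<Rightarrow>real. (\<Sum>i\<le>n. (x i)\<^sup>2) = 1}"
      by (intro closed_Collect_eq continuous_intros continuous_on_product_coordinates)
    moreover have "closed {x::nat\<Rightarrow>real. x i = 0}" for i
      by (intro closed_Collect_eq continuous_intros continuous_on_product_coordinates)
    ultimately show ?thesis by (auto intro!: closed_Int closed_INT)
  qed
  moreover have "sph n \<subseteq> PiE UNIV (\<lambda>i::nat. {-1..1::real})"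
  proof
    fix x assume "x \<in> sph n"
    then have "\<bar>x i\<bar> \<le> 1" for i by (rule sph_abs_le_1)
    then show "x \<in> PiE UNIV (\<lambda>i::nat. {-1..1::real})" by (simp add: PiE_UNIV_domain abs_le_iff minus_le_iff)
  qed
  ultimately show ?thesis
    by (metis compact_Int_closed inf.absorb_iff2)
qed

text \<open>The Lipschitz condition replaces smoothness: it makes general position of the image a
  counting argument, and the maps of the application satisfy it.\<close>

definition lip :: "nat \<Rightarrow> ((nat \<Rightarrow> real) \<Rightarrow> real) \<Rightarrow> bool" where
  "lip n h \<longleftrightarrow> (\<exists>L. \<forall>x\<in>sph n. \<forall>y\<in>sph n. \<bar>h x - h y\<bar> \<le> L * (\<Sum>j\<le>n. \<bar>x j - y j\<bar>))"

lemma lipE: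
  assumes "lip n h"
  obtains L where "L \<ge> 0" "\<And>x y. x \<in> sph n \<Longrightarrow> y \<in> sph n \<Longrightarrow> \<bar>h x - h y\<bar> \<le> L * (\<Sum>j\<le>n. \<bar>x j - y j\<bar>)"
proof -
  obtain L where L: "\<forall>x\<in>sph n. \<forall>y\<in>sph n. \<bar>h x - h y\<bar> \<le> L * (\<Sum>j\<le>n. \<bar>x j - y j\<bar>)"
    using assms unfolding lip_def by blast
  show thesis
  proof (rule that[of "max 0 L"])
    fix x y assume "x \<in> sph n" "y \<in> sph n"
    then have "\<bar>h x - h y\<bar> \<le> L * (\<Sum>j\<le>n. \<bar>x j - y j\<bar>)" using L by blast
    also have "\<dots> \<le> max 0 L * (\<Sum>j\<le>n. \<bar>x j - y j\<bar>)"
      by (intro mult_right_mono) (auto intro: sum_nonneg)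
    finally show "\<bar>h x - h y\<bar> \<le> max 0 L * (\<Sum>j\<le>n. \<bar>x j - y j\<bar>)" .
  qed simp
qed

lemma lip_bounded:
  assumes "lip n h"
  obtains M where "M \<ge> 0" "\<And>x. x \<in> sph n \<Longrightarrow> \<bar>h x\<bar> \<le> M"
proof -
  obtain L where L: "L \<ge> 0" "\<And>x y. x \<in> sph n \<Longrightarrow> y \<in> sph n \<Longrightarrow> \<bar>h x - h y\<bar> \<le> L * (\<Sum>j\<le>n. \<bar>x j - y j\<bar>)"
    using lipE[OF assms] by metis
  define e :: "nat \<Rightarrow> real" where "e = (\<lambda>i. if i = 0 then 1 else 0)"
  have e: "e \<in> sph n"
    using in_topspace_nsphere[of n] unfolding topspace_nsphere e_def by simp
  show thesis
  proof (rule that[of "\<bar>h e\<bar> + L * (\<Sum>j\<le>n. 2)"])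
    show "0 \<le> \<bar>h e\<bar> + L * (\<Sum>j\<le>n. 2)" using L by simp
    fix x assume x: "x \<in> sph n"
    have "\<bar>x j - e j\<bar> \<le> 2" for j
      using sph_abs_le_1[OF x, of j] sph_abs_le_1[OF e, of j] by linarith
    then have "L * (\<Sum>j\<le>n. \<bar>x j - e j\<bar>) \<le> L * (\<Sum>j\<le>n. 2)"
      by (intro mult_left_mono sum_mono L)
    with L(2)[OF x e] show "\<bar>h x\<bar> \<le> \<bar>h e\<bar> + L * (\<Sum>j\<le>n. 2)" by linarith
  qed
qed

section \<open>Closure properties of the Lipschitz condition\<close>

lemma lip_const: "lip n (\<lambda>_. c)"
  unfolding lip_def by (rule exI[of _ 0]) simp

lemma lip_proj: "lip n (\<lambda>x. x k)"
  unfolding lip_def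
proof (rule exI[of _ 1], intro ballI)
  fix x y assume "x \<in> sph n" "y \<in> sph n"
  then show "\<bar>x k - y k\<bar> \<le> 1 * (\<Sum>j\<le>n. \<bar>x j - y j\<bar>)"
    using member_le_sum[of k "{..n}" "\<lambda>j. \<bar>x j - y j\<bar>"]
    by (cases "k \<le> n") (auto simp: sph_iff intro: sum_nonneg)
qed

lemma lip_add:
  assumes "lip n g" "lip n h" shows "lip n (\<lambda>x. g x + h x)"
proof -
  obtain K where K: "K \<ge> 0" "\<And>x y. x \<in> sph n \<Longrightarrow> y \<in> sph n \<Longrightarrow> \<bar>g x - g y\<bar> \<le> K * (\<Sum>j\<le>n. \<bar>x j - y j\<bar>)"
    using lipE[OF assms(1)] by metis
  obtain L where L: "L \<ge> 0" "\<And>x y. x \<in> sph n \<Longrightarrow> y \<in> sph n \<Longrightarrow> \<bar>h x - h y\<bar> \<le> L * (\<Sum>j\<le>n. \<bar>x j - y j\<bar>)"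
    using lipE[OF assms(2)] by metis
  show ?thesis unfolding lip_def
    proof (rule exI[of _ "K + L"], intro ballI)
    fix x y assume "x \<in> sph n" "y \<in> sph n"
    from K(2)[OF this] L(2)[OF this]
    show "\<bar>g x + h x - (g y + h y)\<bar> \<le> (K + L) * (\<Sum>j\<le>n. \<bar>x j - y j\<bar>)"
      unfolding distrib_right by linarith
  qed
qed

lemma lip_mult:
  assumes "lip n g" "lip n h" shows "lip n (\<lambda>x. g x * h x)"
proof -
  obtain K where K: "K \<ge> 0" "\<And>x y. x \<in> sph n \<Longrightarrow> y \<in> sph n \<Longrightarrow> \<bar>g x - g y\<bar> \<le> K * (\<Sum>j\<le>n. \<bar>x j - y j\<bar>)"
    using lipE[OF assms(1)] by metis
  obtain L where L: "L \<ge> 0" "\<And>x y. x \<in> sph n \<Longrightarrow> y \<in> sph n \<Longrightarrow> \<bar>h x - h y\<bar> \<le> L * (\<Sum>j\<le>n. \<bar>x j - y j\<bar>)"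
    using lipE[OF assms(2)] by metis
  obtain M where M: "M \<ge> 0" "\<And>x. x \<in> sph n \<Longrightarrow> \<bar>g x\<bar> \<le> M" using lip_bounded[OF assms(1)] by metis
  obtain N where N: "N \<ge> 0" "\<And>x. x \<in> sph n \<Longrightarrow> \<bar>h x\<bar> \<le> N" using lip_bounded[OF assms(2)] by metis
  show ?thesis unfolding lip_def
  proof (rule exI[of _ "M * L + K * N"], intro ballI)
    fix x y assume x: "x \<in> sph n" and y: "y \<in> sph n"
    let ?d = "\<Sum>j\<le>n. \<bar>x j - y j\<bar>"
    have "g x * h x - g y * h y = g x * (h x - h y) + (g x - g y) * h y" by (simp add: algebra_simps)
    then have "\<bar>g x * h x - g y * h y\<bar> \<le> \<bar>g x\<bar> * \<bar>h x - h y\<bar> + \<bar>g x - g y\<bar> * \<bar>h y\<bar>"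
      using abs_triangle_ineq[of "g x * (h x - h y)" "(g x - g y) * h y"] by (simp add: abs_mult)
    also have "\<dots> \<le> M * (L * ?d) + (K * ?d) * N"
      by (intro add_mono mult_mono K(2) L(2) M N x y mult_nonneg_nonneg K(1)) (auto intro: sum_nonneg)
    finally show "\<bar>g x * h x - g y * h y\<bar> \<le> (M * L + K * N) * ?d" by (simp add: algebra_simps)
  qed
qed

lemma lip_compose:
  assumes "lip n h" and "\<And>s t::real. \<bar>r s - r t\<bar> \<le> \<bar>s - t\<bar>"
  shows "lip n (\<lambda>x. r (h x))"
  using assms unfolding lip_def by (meson order_trans)

lemma lip_uminus: "lip n h \<Longrightarrow> lip n (\<lambda>x. - h x)"
  by (rule lip_compose[where r = uminus]) auto

lemma lip_diff: "lip n g \<Longrightarrow> lip n h \<Longrightarrow> lip n (\<lambda>x. g x - h x)"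
  using lip_add[OF _ lip_uminus] by force

lemma lip_sum: "(\<And>i. i \<in> A \<Longrightarrow> lip n (h i)) \<Longrightarrow> lip n (\<lambda>x. \<Sum>i\<in>A. h i x)"
  by (induction A rule: infinite_finite_induct) (auto intro: lip_const lip_add)

lemma lip_prod: "(\<And>i. i \<in> A \<Longrightarrow> lip n (h i)) \<Longrightarrow> lip n (\<lambda>x. \<Prod>i\<in>A. h i x)"
  by (induction A rule: infinite_finite_induct) (auto intro: lip_const lip_mult)

lemma lip_power: "lip n h \<Longrightarrow> lip n (\<lambda>x. h x ^ k)"
  by (induction k) (auto intro: lip_const lip_mult)

lemma lip_mono:
  assumes "lip n h" "m \<le> n" shows "lip m h"
proof -
  obtain L where L: "L \<ge> 0" "\<And>x y. x \<in> sph n \<Longrightarrow> y \<in> sph n \<Longrightarrow> \<bar>h x - h y\<bar> \<le> L * (\<Sum>j\<le>n. \<bar>x j - y j\<bar>)"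
    using lipE[OF assms(1)] by metis
  show ?thesis unfolding lip_def
  proof (rule exI[of _ L], intro ballI)
    fix x y assume x: "x \<in> sph m" and y: "y \<in> sph m"
    have "(\<Sum>j\<le>n. \<bar>x j - y j\<bar>) = (\<Sum>j\<le>m. \<bar>x j - y j\<bar>)"
      by (rule sum.mono_neutral_right) (use x y assms(2) in \<open>auto simp: sph_iff\<close>)
    with L(2)[of x y] sph_mono[OF assms(2)] x y show "\<bar>h x - h y\<bar> \<le> L * (\<Sum>j\<le>m. \<bar>x j - y j\<bar>)"
      by (metis subsetD)
  qed
qed

lemma lip_continuous_on:
  assumes "lip n h" shows "continuous_on (sph n) h"
proof -
  obtain L where L: "L \<ge> 0" "\<And>x y. x \<in> sph n \<Longrightarrow> y \<in> sph n \<Longrightarrow> \<bar>h x - h y\<bar> \<le> L * (\<Sum>j\<le>n. \<bar>x j - y j\<bar>)"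
    using lipE[OF assms(1)] by metis
  show ?thesis unfolding continuous_on_def
  proof
    fix x assume x: "x \<in> sph n"
    have "continuous_on (sph n) (\<lambda>y. L * (\<Sum>j\<le>n. \<bar>y j - x j\<bar>))"
      by (intro continuous_intros continuous_on_subset[OF continuous_on_product_coordinates]) auto
    then have "((\<lambda>y. L * (\<Sum>j\<le>n. \<bar>y j - x j\<bar>)) \<longlongrightarrow> L * (\<Sum>j\<le>n. \<bar>x j - x j\<bar>)) (at x within sph n)"
      using x unfolding continuous_on_def by blast
    then have lim: "((\<lambda>y. L * (\<Sum>j\<le>n. \<bar>y j - x j\<bar>)) \<longlongrightarrow> 0) (at x within sph n)" by simp
    have "\<forall>\<^sub>F y in at x within sph n. norm (h y - h x) \<le> L * (\<Sum>j\<le>n. \<bar>y j - x j\<bar>)"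
      unfolding eventually_at_filter by (rule eventuallyI) (use L(2) x in auto)
    from Lim_null_comparison[OF this lim] show "(h \<longlongrightarrow> h x) (at x within sph n)"
      by (simp add: LIM_zero_iff)
  qed
qed

text \<open>The extension of \<open>h\<close> to the cone over the sphere, homogeneous of degree 1,
  is again Lipschitz. The difference splits into a radial part with factor \<open>s - t\<close> and
  an angular part with factor \<open>t\<close>; as \<open>s\<close> and \<open>t\<close> are the
  norms of the two points, the triangle inequality bounds both by the distance.\<close>

lemma cone_point_diff:
  assumes x: "x \<in> sph n" and y: "y \<in> sph n" and L: "L \<ge> 0" "\<bar>h x - h y\<bar> \<le> L * (\<Sum>j\<le>n. \<bar>x j - y j\<bar>)"
    and M: "\<bar>h x\<bar> \<le> M" and s: "0 \<le> t" "t \<le> s"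
  shows "\<bar>s * h x - t * h y\<bar> \<le> (M + L * (2 + real n)) * (\<Sum>j\<le>n. \<bar>s * x j - t * y j\<bar>)"
proof -
  define D where "D = (\<Sum>j\<le>n. \<bar>s * x j - t * y j\<bar>)"
  define E where "E = (\<Sum>j\<le>n. \<bar>x j - y j\<bar>)"
  have sx: "L2_set (\<lambda>j. s * x j) {..n} = s" "L2_set (\<lambda>j. t * y j) {..n} = t"
    using s L2_set_sph[OF x] L2_set_sph[OF y]
    by (simp_all flip: L2_set_right_distrib)
  have "s \<le> L2_set (\<lambda>j. s * x j - t * y j) {..n} + t"
    using L2_set_triangle_ineq[of "\<lambda>j. s * x j - t * y j" "\<lambda>j. t * y j" "{..n}"]
    unfolding diff_add_cancel sx .
  then have st: "s - t \<le> D"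
    using L2_set_le_sum_abs[of "\<lambda>j. s * x j - t * y j" "{..n}"] unfolding D_def[symmetric] by linarith
  have "t * \<bar>x j - y j\<bar> \<le> \<bar>s * x j - t * y j\<bar> + (s - t)" for j
  proof -
    have "t * \<bar>x j - y j\<bar> = \<bar>(s * x j - t * y j) - (s - t) * x j\<bar>"
    proof -
      have "(s * x j - t * y j) - (s - t) * x j = t * (x j - y j)" by (simp add: algebra_simps)
      then show ?thesis using s by (simp add: abs_mult)
    qed
    also have "\<dots> \<le> \<bar>s * x j - t * y j\<bar> + (s - t) * \<bar>x j\<bar>"
      using abs_triangle_ineq4[of "s * x j - t * y j" "(s - t) * x j"] abs_of_nonneg[of "s - t"] s(2)
      unfolding abs_mult by linarith
    also have "(s - t) * \<bar>x j\<bar> \<le> (s - t) * 1"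
      using s sph_abs_le_1[OF x, of j] by (intro mult_left_mono) auto
    finally show ?thesis by (simp only: mult_1_right)
  qed
  then have "(\<Sum>j\<le>n. t * \<bar>x j - y j\<bar>) \<le> (\<Sum>j\<le>n. \<bar>s * x j - t * y j\<bar> + (s - t))"
    by (intro sum_mono)
  also have "\<dots> = D + (real n + 1) * (s - t)" by (simp add: sum.distrib D_def)
  also have "\<dots> \<le> D + (real n + 1) * D" using st by (intro add_left_mono mult_left_mono) auto
  finally have txy: "t * E \<le> (2 + real n) * D"
    by (simp add: E_def sum_distrib_left algebra_simps)
  have "s * h x - t * h y = (s - t) * h x + t * (h x - h y)" by (simp add: algebra_simps)
  then have "\<bar>s * h x - t * h y\<bar> \<le> (s - t) * \<bar>h x\<bar> + t * \<bar>h x - h y\<bar>"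
    using abs_triangle_ineq[of "(s - t) * h x" "t * (h x - h y)"] s
    by (simp only: abs_mult abs_of_nonneg diff_ge_0_iff_ge)
  also have "\<dots> \<le> D * M + t * (L * E)"
    using s L(1) L(2)[folded E_def] M st by (intro add_mono mult_mono) linarith+
  also have "t * (L * E) \<le> L * ((2 + real n) * D)"
    using mult_left_mono[OF txy L(1)] by (simp add: algebra_simps)
  finally show ?thesis unfolding D_def[symmetric] by (simp add: algebra_simps)
qed

text \<open>Otherwise the \<open>K\<^sup>n\<^sup>+\<^sup>2\<close> points of a grid would have preimages in distinct cells of a
  partition of a cube in dimension \<open>n + 1\<close> into \<open>O(K\<^sup>n\<^sup>+\<^sup>1)\<close> cells.\<close>

lemma lip_cone_misses_ray:
  assumes lip: "\<And>i. i \<le> Suc n \<Longrightarrow> lip n (\<lambda>x. F x i)"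
    and nz: "\<And>x. x \<in> sph n \<Longrightarrow> \<exists>i\<le>Suc n. F x i \<noteq> 0"
  obtains p where "p \<in> sph (Suc n)" "\<And>x t. x \<in> sph n \<Longrightarrow> t > 0 \<Longrightarrow> \<exists>i\<le>Suc n. F x i \<noteq> t * p i"
proof (rule ccontr)
  assume "\<not> thesis"
  with that have cover: "\<exists>x\<in>sph n. \<exists>t>0. \<forall>i\<le>Suc n. F x i = t * p i" if "p \<in> sph (Suc n)" for p
    using that by metis
  have "\<exists>L. i \<le> Suc n \<longrightarrow> 0 \<le> L \<and>
      (\<forall>x\<in>sph n. \<forall>y\<in>sph n. \<bar>F x i - F y i\<bar> \<le> L * (\<Sum>j\<le>n. \<bar>x j - y j\<bar>))" for i
  proof (cases "i \<le> Suc n")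
    case True
    show ?thesis by (rule lipE[OF lip[OF True]]) blast
  qed simp
  then have "\<exists>L. \<forall>i. i \<le> Suc n \<longrightarrow> 0 \<le> L i \<and>
      (\<forall>x\<in>sph n. \<forall>y\<in>sph n. \<bar>F x i - F y i\<bar> \<le> L i * (\<Sum>j\<le>n. \<bar>x j - y j\<bar>))"
    by (intro choice allI)
  then obtain L0 where L0: "\<And>i. i \<le> Suc n \<Longrightarrow> L0 i \<ge> 0"
    "\<And>i x y. i \<le> Suc n \<Longrightarrow> x \<in> sph n \<Longrightarrow> y \<in> sph n \<Longrightarrow> \<bar>F x i - F y i\<bar> \<le> L0 i * (\<Sum>j\<le>n. \<bar>x j - y j\<bar>)"
    by blast
  have "\<exists>M. i \<le> Suc n \<longrightarrow> 0 \<le> M \<and> (\<forall>x\<in>sph n. \<bar>F x i\<bar> \<le> M)" for i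
  proof (cases "i \<le> Suc n")
    case True
    show ?thesis by (rule lip_bounded[OF lip[OF True]]) blast
  qed simp
  then have "\<exists>M. \<forall>i. i \<le> Suc n \<longrightarrow> 0 \<le> M i \<and> (\<forall>x\<in>sph n. \<bar>F x i\<bar> \<le> M i)"
    by (intro choice allI)
  then obtain M0 where M0: "\<And>i. i \<le> Suc n \<Longrightarrow> M0 i \<ge> 0"
    "\<And>i x. i \<le> Suc n \<Longrightarrow> x \<in> sph n \<Longrightarrow> \<bar>F x i\<bar> \<le> M0 i"
    by blast
  \<comment> \<open>One Lipschitz constant for all coordinates of the cone map; the added 1 makes it
    positive.\<close>
  define \<Lambda> where "\<Lambda> = (\<Sum>i\<le>Suc n. M0 i + L0 i * (2 + real n)) + 1"
  have \<Lambda>i: "M0 i + L0 i * (2 + real n) \<le> \<Lambda>" if "i \<le> Suc n" for i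
    using member_le_sum[of i "{..Suc n}" "\<lambda>i. M0 i + L0 i * (2 + real n)"] that M0(1) L0(1)
    unfolding \<Lambda>_def by fastforce
  have "\<Lambda> > 0" unfolding \<Lambda>_def using M0(1) L0(1) by (intro add_nonneg_pos sum_nonneg) auto
  have cone: "\<bar>s * F x i - t * F y i\<bar> \<le> \<Lambda> * (\<Sum>j\<le>n. \<bar>s * x j - t * y j\<bar>)"
    if "i \<le> Suc n" "x \<in> sph n" "y \<in> sph n" "0 \<le> s" "0 \<le> t" for i x y s t
  proof -
    have le: "(M0 i + L0 i * (2 + real n)) * (\<Sum>j\<le>n. \<bar>s * x j - t * y j\<bar>) \<le> \<Lambda> * (\<Sum>j\<le>n. \<bar>s * x j - t * y j\<bar>)"
      using \<Lambda>i[OF that(1)] by (intro mult_right_mono) (auto intro: sum_nonneg)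
    show ?thesis
    proof (cases "t \<le> s")
      case True
      from cone_point_diff[OF that(2,3) L0(1)[OF that(1)] L0(2)[OF that(1,2,3)] M0(2)[OF that(1,2)] that(5) True] le
      show ?thesis by linarith
    next
      case False
      then have "s \<le> t" by simp
      from cone_point_diff[OF that(3,2) L0(1)[OF that(1)] L0(2)[OF that(1,3,2)] M0(2)[OF that(1,3)] that(4) this] le
      show ?thesis by (simp add: abs_minus_commute)
    qed
  qed
  have cont: "continuous_on (sph n) (\<lambda>x. L2_set (F x) {..Suc n})"
    unfolding L2_set_def using lip by (intro continuous_intros lip_continuous_on) auto
  have ne: "sph n \<noteq> {}" using in_topspace_nsphere[of n] unfolding topspace_nsphere by blast
  obtain x0 where x0: "x0 \<in> sph n" "\<And>x. x \<in> sph n \<Longrightarrow> L2_set (F x0) {..Suc n} \<le> L2_set (F x) {..Suc n}"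
    using continuous_attains_inf[OF compact_sph ne cont] by blast
  \<comment> \<open>The least norm of \<open>F\<close> is positive by compactness, so a grid point
    of norm at most \<open>(n + 2) * K\<close> is reached at radius at most
    \<open>R * K\<close>.\<close>
  define \<epsilon> where "\<epsilon> = L2_set (F x0) {..Suc n}"
  have "\<epsilon> \<noteq> 0" unfolding \<epsilon>_def using nz[OF x0(1)] by (subst L2_set_eq_0_iff) auto
  then have "\<epsilon> > 0" unfolding \<epsilon>_def by (simp add: order.strict_iff_order)
  \<comment> \<open>The width of a cell: cone points in one cell have images less than 1 apart in
    each coordinate, so they cannot hit two different integer vectors.\<close>
  define \<delta> where "\<delta> = 1 / (\<Lambda> * (real n + 2))"
  have "\<delta> > 0" using \<open>\<Lambda> > 0\<close> unfolding \<delta>_def by simp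
  define R where "R = (real n + 2) / \<epsilon>"
  have "R > 0" using \<open>\<epsilon> > 0\<close> unfolding R_def by simp
  \<comment> \<open>\<open>B * K\<close> bounds the number of cells along one axis for all
    \<open>K\<close> from 1 on. Taking \<open>K\<close> above \<open>B ^ Suc n\<close> makes the
    grid, with one dimension more, larger than the set of cells.\<close>
  define B where "B = nat \<lceil>2 * (R / \<delta> + 1) + 1\<rceil>"
  have B: "2 * (R / \<delta> + 1) + 1 \<le> real B" unfolding B_def by linarith
  define K where "K = Suc (B ^ Suc n)"
  \<comment> \<open>Coordinates start at 1, so that grid vectors are nonzero and can be
    normalized.\<close>
  define Q where "Q = PiE {..Suc n} (\<lambda>_. {1..K})"
  have cQ: "card Q = K ^ (n + 2)" unfolding Q_def by (subst card_PiE) auto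
  have ex: "\<exists>x s. x \<in> sph n \<and> 0 \<le> s \<and> s \<le> R * K \<and> (\<forall>i\<le>Suc n. s * F x i = real (q i))" if q: "q \<in> Q" for q
  proof -
    define N where "N = L2_set (\<lambda>i. real (q i)) {..Suc n}"
    have q1: "1 \<le> q i" "q i \<le> K" if "i \<le> Suc n" for i using q that unfolding Q_def by fastforce+
    have "N \<noteq> 0" unfolding N_def using q1(1)[of 0] by (subst L2_set_eq_0_iff) (auto intro!: bexI[of _ 0])
    then have "N > 0" unfolding N_def by (simp add: order.strict_iff_order)
    have "N \<le> (\<Sum>i\<le>Suc n. real (q i))" unfolding N_def by (rule L2_set_le_sum) simp
    also have "\<dots> \<le> (\<Sum>i\<le>Suc n. real K)" using q1(2) by (intro sum_mono) auto
    finally have N: "N \<le> (real n + 2) * K" by (simp add: algebra_simps)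
    define p where "p = (\<lambda>i. if i \<le> Suc n then real (q i) / N else 0)"
    have "(\<Sum>i\<le>Suc n. (p i)\<^sup>2) = (\<Sum>i\<le>Suc n. (real (q i))\<^sup>2) / N\<^sup>2"
      unfolding p_def by (simp add: power_divide sum_divide_distrib add_divide_distrib)
    also have "(\<Sum>i\<le>Suc n. (real (q i))\<^sup>2) = N\<^sup>2" unfolding N_def L2_set_def by (simp add: sum_nonneg)
    finally have "p \<in> sph (Suc n)" using \<open>N > 0\<close> by (simp add: sph_iff p_def)
    then obtain x t where xt: "x \<in> sph n" "t > 0" "\<forall>i\<le>Suc n. F x i = t * p i" using cover by blast
    have "L2_set (F x) {..Suc n} = L2_set (\<lambda>i. t * p i) {..Suc n}" using xt by (intro L2_set_cong) auto
    also have "\<dots> = t * L2_set p {..Suc n}" using xt by (simp add: L2_set_right_distrib)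
    also have "\<dots> = t" using L2_set_sph[OF \<open>p \<in> sph (Suc n)\<close>] by simp
    finally have "\<epsilon> \<le> t" using x0(2)[OF xt(1)] unfolding \<epsilon>_def by simp
    have "N / t \<le> ((real n + 2) * K) / \<epsilon>"
      using N \<open>N > 0\<close> \<open>\<epsilon> \<le> t\<close> \<open>\<epsilon> > 0\<close> by (intro frac_le) auto
    then have "N / t \<le> R * K" unfolding R_def by simp
    moreover have "N / t * F x i = real (q i)" if "i \<le> Suc n" for i
      using xt that \<open>N > 0\<close> by (simp add: p_def)
    ultimately show ?thesis using xt \<open>N > 0\<close> by (intro exI[of _ x] exI[of _ "N / t"]) auto
  qed
  then obtain X S where XS: "\<And>q. q \<in> Q \<Longrightarrow> X q \<in> sph n" "\<And>q. q \<in> Q \<Longrightarrow> 0 \<le> S q" "\<And>q. q \<in> Q \<Longrightarrow> S q \<le> R * K"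
    "\<And>q i. q \<in> Q \<Longrightarrow> i \<le> Suc n \<Longrightarrow> S q * F (X q) i = real (q i)"
    by metis
  define D where "D = \<lceil>R * K / \<delta>\<rceil>"
  define cell where "cell = (\<lambda>q. \<lambda>j\<in>{..n}. \<lfloor>S q * X q j / \<delta>\<rfloor>)"
  have "inj_on cell Q"
  proof (rule inj_onI)
    fix q r assume q: "q \<in> Q" and r: "r \<in> Q" and eq: "cell q = cell r"
    have "\<bar>S q * X q j - S r * X r j\<bar> \<le> \<delta>" if "j \<le> n" for j
    proof -
      have "\<lfloor>S q * X q j / \<delta>\<rfloor> = \<lfloor>S r * X r j / \<delta>\<rfloor>"
        using fun_cong[OF eq, of j] that unfolding cell_def by simp
      then have "\<bar>S q * X q j / \<delta> - S r * X r j / \<delta>\<bar> \<le> 1" by linarith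
      then have "\<bar>S q * X q j - S r * X r j\<bar> / \<delta> \<le> 1"
        using \<open>\<delta> > 0\<close> by (simp flip: diff_divide_distrib)
      then show ?thesis using \<open>\<delta> > 0\<close> by simp
    qed
    then have "(\<Sum>j\<le>n. \<bar>S q * X q j - S r * X r j\<bar>) \<le> (\<Sum>j\<le>n. \<delta>)" by (intro sum_mono) auto
    then have "\<Lambda> * (\<Sum>j\<le>n. \<bar>S q * X q j - S r * X r j\<bar>) \<le> \<Lambda> * ((real n + 1) * \<delta>)"
      using \<open>\<Lambda> > 0\<close> by (intro mult_left_mono) (auto simp: algebra_simps)
    also have "\<dots> = (real n + 1) / (real n + 2)" unfolding \<delta>_def using \<open>\<Lambda> > 0\<close> by simp
    also have "\<dots> < 1" by simp
    finally have "\<bar>real (q i) - real (r i)\<bar> < 1" if "i \<le> Suc n" for i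
      using cone[OF that XS(1)[OF q] XS(1)[OF r] XS(2)[OF q] XS(2)[OF r]] XS(4) q r that by fastforce
    then have "q i = r i" if "i \<le> Suc n" for i using that by fastforce
    then show "q = r" using q r unfolding Q_def by (intro PiE_ext[OF q[unfolded Q_def] r[unfolded Q_def]]) auto
  qed
  moreover have "cell ` Q \<subseteq> PiE {..n} (\<lambda>_. {-D..D})"
  proof (intro image_subsetI PiE_I)
    fix q j assume q: "q \<in> Q" and "j \<in> {..n}"
    have "\<bar>S q * X q j\<bar> \<le> R * K * 1"
      unfolding abs_mult using XS(2)[OF q] XS(3)[OF q] sph_abs_le_1[OF XS(1)[OF q], of j] \<open>R > 0\<close>
      by (intro mult_mono) auto
    then have "\<bar>S q * X q j / \<delta>\<bar> \<le> R * K / \<delta>" using \<open>\<delta> > 0\<close> by (simp add: divide_right_mono)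
    moreover have "- \<lceil>b\<rceil> \<le> \<lfloor>y\<rfloor> \<and> \<lfloor>y\<rfloor> \<le> \<lceil>b\<rceil>" if "\<bar>y\<bar> \<le> b" for y b :: real
      using that by linarith
    ultimately show "cell q j \<in> {-D..D}" using \<open>j \<in> {..n}\<close> unfolding cell_def D_def restrict_def by auto
  next
    fix q j assume "j \<notin> {..n}"
    then show "cell q j = undefined" by (simp add: cell_def)
  qed
  ultimately have "card Q \<le> card (PiE {..n} (\<lambda>_. {-D..D}))"
    by (meson card_inj_on_le finite_PiE finite_atLeastAtMost_int finite_atMost)
  also have "\<dots> = nat (2 * D + 1) ^ Suc n" by (subst card_PiE) (simp_all add: algebra_simps)
  also have "\<dots> \<le> (B * K) ^ Suc n"
  proof (rule power_mono)
    have "real_of_int (2 * \<lceil>b\<rceil> + 1) \<le> 2 * (b + 1) + 1" for b :: real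
      using of_int_ceiling_le_add_one[of b] unfolding of_int_add of_int_mult of_int_numeral of_int_1 by argo
    then have "real_of_int (2 * D + 1) \<le> 2 * (R * K / \<delta> + 1) + 1" unfolding D_def .
    also have "\<dots> \<le> (2 * (R / \<delta> + 1) + 1) * K"
    proof -
      have "1 \<le> real K" unfolding K_def by simp
      then show ?thesis by (simp add: algebra_simps)
    qed
    also have "\<dots> \<le> real B * K" using B by (intro mult_right_mono) auto
    finally have "real_of_int (2 * D + 1) \<le> real_of_int (int (B * K))" by simp
    then show "nat (2 * D + 1) \<le> B * K" by linarith
  qed simp
  finally have "K ^ Suc n * K \<le> K ^ Suc n * B ^ Suc n"
    unfolding cQ by (simp add: power_mult_distrib algebra_simps)
  then have "K \<le> B ^ Suc n" by (simp add: K_def)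
  then show False by (simp add: K_def)
qed

subsection \<open>Odd maps between spheres\<close>

text \<open>The zero vector is sent to itself, which is not on the sphere.\<close>

definition nrm :: "nat \<Rightarrow> (nat \<Rightarrow> real) \<Rightarrow> nat \<Rightarrow> real" where
  "nrm n v = (\<lambda>i. if i \<le> n then v i / L2_set v {..n} else 0)"

lemma L2_set_pos_iff: "L2_set v {..n::nat} > 0 \<longleftrightarrow> (\<exists>i\<le>n. v i \<noteq> 0)"
  using L2_set_eq_0_iff[of "{..n}" v] L2_set_nonneg[of v "{..n}"] by (auto simp: less_le)

lemma nrm_in_sph: "\<exists>i\<le>n. v i \<noteq> 0 \<Longrightarrow> nrm n v \<in> sph n"
proof -
  assume "\<exists>i\<le>n. v i \<noteq> 0"
  then have pos: "L2_set v {..n} > 0" by (simp add: L2_set_pos_iff)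
  have "(\<Sum>i\<le>n. (nrm n v i)\<^sup>2) = (\<Sum>i\<le>n. (v i)\<^sup>2) / (L2_set v {..n})\<^sup>2"
    by (simp add: nrm_def power_divide sum_divide_distrib)
  also have "(\<Sum>i\<le>n. (v i)\<^sup>2) = (L2_set v {..n})\<^sup>2" by (simp add: L2_set_def sum_nonneg)
  finally show ?thesis using pos by (simp add: sph_iff nrm_def)
qed

lemma nrm_uminus: "nrm n (\<lambda>i. - v i) = (\<lambda>i. - nrm n v i)"
  by (auto simp: nrm_def L2_set_def)

lemma continuous_on_nrm:
  assumes "\<And>i. i \<le> n \<Longrightarrow> continuous_on S (\<lambda>x. F x i)" "\<And>x. x \<in> S \<Longrightarrow> \<exists>i\<le>n. F x i \<noteq> 0"
  shows "continuous_on S (\<lambda>x. nrm n (F x))"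
proof (rule continuous_on_coordinatewise_then_product)
  fix i
  have "L2_set (F x) {..n} \<noteq> 0" if "x \<in> S" for x using assms(2)[OF that] L2_set_pos_iff[of "F x" n] by simp
  then show "continuous_on S (\<lambda>x. nrm n (F x) i)"
    using assms(1) unfolding nrm_def
    by (cases "i \<le> n") (auto intro!: continuous_intros simp: L2_set_def)
qed

lemma continuous_map_nsphere:
  "continuous_map (nsphere n) (nsphere m) f \<longleftrightarrow> continuous_on (sph n) f \<and> f \<in> sph n \<rightarrow> sph m"
  by (simp add: nsphere_top_of_set continuous_map_in_subtopology image_subset_iff_funcset)

section \<open>Reflections in hyperplanes\<close>

definition inner_upto :: "nat \<Rightarrow> (nat \<Rightarrow> real) \<Rightarrow> (nat \<Rightarrow> real) \<Rightarrow> real" where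
  "inner_upto n u v = (\<Sum>i\<le>n. u i * v i)"

text \<open>The reflection in the hyperplane orthogonal to \<open>w\<close>. If \<open>w\<close>
  vanishes up to \<open>n\<close>, division by zero turns it into the identity, which is the right
  map for a vector that is already in place.\<close>

definition householder :: "nat \<Rightarrow> (nat \<Rightarrow> real) \<Rightarrow> (nat \<Rightarrow> real) \<Rightarrow> nat \<Rightarrow> real" where
  "householder n w u = (\<lambda>i. u i - 2 * inner_upto n u w / inner_upto n w w * w i)"

lemma inner_upto_diff_scale:
  "inner_upto n (\<lambda>i. u i - c * w i) v = inner_upto n u v - c * inner_upto n w v"
  by (simp add: inner_upto_def algebra_simps sum_subtractf sum_distrib_left)

lemma inner_upto_commute: "inner_upto n u v = inner_upto n v u"
  by (simp add: inner_upto_def mult.commute)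

lemma inner_upto_self_eq_0: "inner_upto n w w = 0 \<longleftrightarrow> (\<forall>i\<le>n. w i = 0)"
  by (auto simp: inner_upto_def sum_nonneg_eq_0_iff)

lemma inner_upto_householder_self:
  "inner_upto n (householder n w u) (householder n w u) = inner_upto n u u"
proof (cases "inner_upto n w w = 0")
  case True
  then show ?thesis by (simp add: householder_def)
next
  case False
  define c where "c = 2 * inner_upto n u w / inner_upto n w w"
  have c: "c * inner_upto n w w = 2 * inner_upto n u w" using False by (simp add: c_def)
  have "inner_upto n (householder n w u) (householder n w u)
      = inner_upto n u (householder n w u) - c * inner_upto n w (householder n w u)"
    by (simp add: householder_def inner_upto_diff_scale flip: c_def)
  also have "inner_upto n u (householder n w u) = inner_upto n u u - c * inner_upto n w u"
    by (subst inner_upto_commute) (simp add: householder_def inner_upto_diff_scale flip: c_def)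
  also have "inner_upto n w (householder n w u) = inner_upto n u w - c * inner_upto n w w"
    by (subst inner_upto_commute) (simp add: householder_def inner_upto_diff_scale flip: c_def)
  finally show ?thesis using c by (simp add: inner_upto_commute[of n w u])
qed

lemma householder_involution: "householder n w (householder n w u) = u"
proof (cases "inner_upto n w w = 0")
  case True
  then show ?thesis by (simp add: householder_def)
next
  case False
  define c where "c = 2 * inner_upto n u w / inner_upto n w w"
  have c: "c * inner_upto n w w = 2 * inner_upto n u w" using False by (simp add: c_def)
  have "inner_upto n (householder n w u) w = inner_upto n u w - c * inner_upto n w w"
    by (simp add: householder_def inner_upto_diff_scale flip: c_def)
  then have "2 * inner_upto n (householder n w u) w / inner_upto n w w = - c"
    using c by (simp add: c_def)
  then show ?thesis
    unfolding householder_def[of n w "householder n w u"] by (simp add: householder_def flip: c_def)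
qed

lemma L2_set_inner_upto: "L2_set v {..n} = sqrt (inner_upto n v v)"
  by (simp add: L2_set_def inner_upto_def power2_eq_square)

lemma householder_scale: "householder n w (\<lambda>i. c * u i) = (\<lambda>i. c * householder n w u i)"
proof -
  have "inner_upto n (\<lambda>i. c * u i) w = c * inner_upto n u w"
    by (simp add: inner_upto_def sum_distrib_left mult.assoc)
  then show ?thesis by (simp add: householder_def algebra_simps)
qed

lemma householder_cong:
  assumes "\<And>i. i \<le> n \<Longrightarrow> u i = v i" "i \<le> n"
  shows "householder n w u i = householder n w v i"
proof -
  have "inner_upto n u w = inner_upto n v w" by (simp add: inner_upto_def assms)
  then show ?thesis using assms by (simp add: householder_def)
qed

lemma sph_iff_inner: "x \<in> sph n \<longleftrightarrow> inner_upto n x x = 1 \<and> (\<forall>i>n. x i = 0)"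
  by (simp add: sph_iff inner_upto_def power2_eq_square)

lemma homeomorphic_map_householder:
  assumes "\<forall>i>n. w i = 0"
  shows "homeomorphic_map (nsphere n) (nsphere n) (householder n w)"
proof -
  have "continuous_on (sph n) (householder n w)"
    unfolding householder_def inner_upto_def divide_inverse
    by (rule continuous_on_coordinatewise_then_product)
      (intro continuous_intros lip_continuous_on[OF lip_proj])
  then have "continuous_map (nsphere n) (nsphere n) (householder n w)"
    using assms unfolding continuous_map_nsphere
    by (auto simp: sph_iff_inner inner_upto_householder_self) (simp add: householder_def)
  then show ?thesis
    unfolding homeomorphic_map_maps homeomorphic_maps_def
    by (intro exI[of _ "householder n w"]) (simp add: householder_involution)
qed

text \<open>Two unit vectors are exchanged by the reflection along their difference.\<close>

lemma householder_maps_to_axis: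
  assumes p: "p \<in> sph n"
  defines "e \<equiv> \<lambda>i. if i = n then 1 else (0::real)"
  shows "householder n (\<lambda>i. p i - e i) p = e"
proof (cases "inner_upto n (\<lambda>i. p i - e i) (\<lambda>i. p i - e i) = 0")
  case True
  then have "\<forall>i\<le>n. p i - e i = 0" by (simp add: inner_upto_self_eq_0)
  then have "p = e" using p by (auto simp: e_def sph_iff fun_eq_iff) (metis linorder_not_less)
  then show ?thesis by (simp add: householder_def)
next
  case False
  let ?w = "\<lambda>i. p i - e i"
  have pe: "inner_upto n p e = p n" "inner_upto n e p = p n" "inner_upto n e e = 1"
    by (simp_all add: inner_upto_def e_def if_distrib[of "\<lambda>t. _ * t"] if_distrib[of "\<lambda>t. t * _"] cong: if_cong)
  have pp: "inner_upto n p p = 1" using p by (simp add: sph_iff_inner)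
  have pw: "inner_upto n p ?w = 1 - p n"
    using inner_upto_diff_scale[of n p 1 e p] pp pe by (simp add: inner_upto_commute[of n p ?w])
  have ew: "inner_upto n e ?w = p n - 1"
    using inner_upto_diff_scale[of n p 1 e e] pp pe by (simp add: inner_upto_commute[of n e ?w])
  have ww: "inner_upto n ?w ?w = 2 * (1 - p n)"
    using inner_upto_diff_scale[of n p 1 e ?w] pw ew by simp
  have "2 * inner_upto n p ?w / inner_upto n ?w ?w = 1"
    using False unfolding ww pw by simp
  then show ?thesis by (simp add: householder_def)
qed

section \<open>Degrees of odd maps and the Borsuk-Ulam theorem\<close>

lemma odd_maps_sphere_0:
  assumes f: "f \<in> sph 0 \<rightarrow> sph 0" and odd: "\<And>x. x \<in> sph 0 \<Longrightarrow> f (\<lambda>i. - x i) = (\<lambda>i. - f x i)"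
  shows "odd (Brouwer_degree2 0 f)"
proof -
  define e where "e = (\<lambda>i::nat. if i = 0 then 1 else (0::real))"
  have sph0: "x \<in> sph 0 \<longleftrightarrow> x = e \<or> x = (\<lambda>i. - e i)" for x
  proof
    assume x: "x \<in> sph 0"
    then have "x 0 = 1 \<or> x 0 = -1" by (simp add: sph_iff power2_eq_1_iff)
    then show "x = e \<or> x = (\<lambda>i. - e i)" using x unfolding e_def sph_iff by (auto simp: fun_eq_iff)
  qed (auto simp: e_def sph_iff)
  have oe: "f (\<lambda>i. - e i) = (\<lambda>i. - f e i)" using odd[of e] sph0 by simp
  have "f e \<in> sph 0" using f sph0 by blast
  \<comment> \<open>By oddness the value at one of the two points decides: \<open>f\<close> acts as
    the identity or as the reflection, of degree 1 or -1.\<close>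
  then consider "f e = e" | "f e = (\<lambda>i. - e i)" using sph0 by blast
  then show ?thesis
  proof cases
    case 1
    then have "Brouwer_degree2 0 f = Brouwer_degree2 0 id"
      by (intro Brouwer_degree2_eq) (use oe in \<open>auto simp: topspace_nsphere sph0\<close>)
    then show ?thesis by simp
  next
    case 2
    have "f x = (\<lambda>i. if i = 0 then - x i else x i)" if x: "x \<in> sph 0" for x
    proof -
      have "(\<lambda>i. if i = 0 then - x i else x i) = (\<lambda>i. - x i)"
        using x by (auto simp: sph_iff)
      moreover have "f x = (\<lambda>i. - x i)"
        using x[unfolded sph0] oe[unfolded 2] 2 by auto
      ultimately show ?thesis by simp
    qed
    then have "Brouwer_degree2 0 f = Brouwer_degree2 0 (\<lambda>x i. if i = 0 then - x i else x i)"
      by (intro Brouwer_degree2_eq) (simp only: topspace_nsphere)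
    then show ?thesis by (simp add: Brouwer_degree2_reflection)
  qed
qed

text \<open>The straight-line homotopy avoids the origin and can therefore be normalized onto the
  sphere.\<close>

lemma homotopic_nrm:
  assumes F: "\<And>i. i \<le> n \<Longrightarrow> continuous_on (sph n) (\<lambda>x. F x i)"
    and G: "\<And>i. i \<le> n \<Longrightarrow> continuous_on (sph n) (\<lambda>x. G x i)"
    and nz: "\<And>s x. 0 \<le> s \<Longrightarrow> s \<le> 1 \<Longrightarrow> x \<in> sph n \<Longrightarrow> \<exists>i\<le>n. (1 - s) * F x i + s * G x i \<noteq> 0"
  shows "Brouwer_degree2 n (\<lambda>x. nrm n (F x)) = Brouwer_degree2 n (\<lambda>x. nrm n (G x))"
proof (rule Brouwer_degree2_homotopic)
  define H where "H = (\<lambda>z. nrm n (\<lambda>i. (1 - fst z) * F (snd z) i + fst z * G (snd z) i))"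
  have "continuous_on ({0..1} \<times> sph n) (\<lambda>z. F (snd z) i)" if "i \<le> n" for i
    by (rule continuous_on_compose2[OF F[OF that]]) (auto intro: continuous_intros)
  moreover have "continuous_on ({0..1} \<times> sph n) (\<lambda>z. G (snd z) i)" if "i \<le> n" for i
    by (rule continuous_on_compose2[OF G[OF that]]) (auto intro: continuous_intros)
  ultimately have "continuous_on ({0..1} \<times> sph n) H"
    unfolding H_def by (intro continuous_on_nrm continuous_intros) (use nz in auto)
  moreover have "H \<in> {0..1} \<times> sph n \<rightarrow> sph n"
    unfolding H_def using nz by (auto intro!: nrm_in_sph)
  ultimately show "homotopic_with (\<lambda>x. True) (nsphere n) (nsphere n) (\<lambda>x. nrm n (F x)) (\<lambda>x. nrm n (G x))"
    unfolding nsphere_top_of_set homotopic_with_def prod_topology_subtopology_eu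
    by (intro exI[of _ H] conjI) (simp_all add: continuous_map_in_subtopology image_subset_iff_funcset, simp_all add: H_def)
qed

text \<open>A reflection moves a direction missed by the image of the equator to the last axis. Scaling the
  last coordinate of the value at \<open>x\<close> by \<open>1 - s + s x\<^sub>n\<^sub>+\<^sub>1\<^sup>2\<close> then never produces a zero, and at \<open>s = 1\<close>
  the equator is mapped to itself, so that the degrees on sphere and equator agree modulo 2.\<close>

lemma Borsuk_odd_mapping_degree_lip:
  assumes "\<And>i. i \<le> n \<Longrightarrow> lip n (\<lambda>x. F x i)"
    and "\<And>x i. x \<in> sph n \<Longrightarrow> i \<le> n \<Longrightarrow> F (\<lambda>j. - x j) i = - F x i"
    and "\<And>x. x \<in> sph n \<Longrightarrow> \<exists>i\<le>n. F x i \<noteq> 0"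
  shows "odd (Brouwer_degree2 n (\<lambda>x. nrm n (F x)))"
  using assms
proof (induction n arbitrary: F)
  case 0
  have "nrm 0 (F (\<lambda>i. - x i)) = (\<lambda>i. - nrm 0 (F x) i)" if "x \<in> sph 0" for x
    using "0.prems"(2)[OF that] by (auto simp: nrm_def fun_eq_iff)
  then show ?case
    using "0.prems"(3) by (intro odd_maps_sphere_0) (auto intro!: nrm_in_sph)
next
  case (Suc n)
  let ?N = "Suc n"
  note lip = Suc.prems(1) and odd = Suc.prems(2) and nz = Suc.prems(3)
  have sub: "sph n \<subseteq> sph ?N" by (rule sph_mono) simp
  obtain p where p: "p \<in> sph ?N" "\<And>x t. x \<in> sph n \<Longrightarrow> t > 0 \<Longrightarrow> \<exists>i\<le>?N. F x i \<noteq> t * p i"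
    by (rule lip_cone_misses_ray[of n F]) (use lip lip_mono[of ?N] nz sub in auto)
  define e where "e = (\<lambda>i. if i = ?N then 1 else (0::real))"
  define w where "w = (\<lambda>i. p i - e i)"
  define T where "T = householder ?N w"
  have Tp: "T p = e" using householder_maps_to_axis[OF p(1)] by (simp add: T_def w_def e_def)
  have TT: "T (T u) = u" for u by (simp add: T_def householder_involution)
  have T0: "T u i = 0" if "\<forall>i\<le>?N. u i = 0" "i \<le> ?N" for u i
    using that by (simp add: T_def householder_def inner_upto_def)
  have Tcong: "T u i = T v i" if "\<And>i. i \<le> ?N \<Longrightarrow> u i = v i" "i \<le> ?N" for u v i
    using that unfolding T_def by (rule householder_cong)
  define G where "G = (\<lambda>x. T (F x))"
  have lipG: "lip ?N (\<lambda>x. G x i)" if "i \<le> ?N" for i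
    unfolding G_def T_def householder_def inner_upto_def divide_inverse
    by (intro lip_diff lip_mult lip_sum lip_const) (use lip that in auto)
  have contG: "continuous_on (sph ?N) (\<lambda>x. G x i)" if "i \<le> ?N" for i
    by (rule lip_continuous_on[OF lipG[OF that]])
  have oddG: "G (\<lambda>j. - x j) i = - G x i" if "x \<in> sph ?N" "i \<le> ?N" for x i
  proof -
    have "T (F (\<lambda>j. - x j)) i = T (\<lambda>i. - 1 * F x i) i"
      by (rule Tcong) (use odd that in auto)
    also have "\<dots> = - T (F x) i" unfolding T_def householder_scale by simp
    finally show ?thesis by (simp add: G_def)
  qed
  have nzG: "\<exists>i\<le>?N. G x i \<noteq> 0" if "x \<in> sph ?N" for x
  proof (rule ccontr)
    assume "\<not> ?thesis"
    then have "T (G x) i = 0" if "i \<le> ?N" for i using T0[of "G x" i] that by blast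
    then show False using nz[OF that] by (auto simp: G_def TT)
  qed
  \<comment> \<open>On the equator \<open>G\<close> avoids the whole last axis: the positive half is
    the image of the missed ray under \<open>T\<close>, and the negative half follows by oddness.
    Dropping the last coordinate thus leaves a map for the induction hypothesis.\<close>
  have eqG: "\<exists>i\<le>n. G x i \<noteq> 0" if "x \<in> sph n" for x
  proof (rule ccontr)
    assume "\<not> ?thesis"
    then have z: "G x i = 0" if "i \<le> n" for i using that by blast
    have pos: False if y: "y \<in> sph n" and z: "\<And>i. i \<le> n \<Longrightarrow> G y i = 0" and "G y ?N > 0" for y
    proof -
      have "F y i = G y ?N * p i" if "i \<le> ?N" for i
      proof -
        have "F y i = T (G y) i" by (simp add: G_def TT)
        also have "\<dots> = T (\<lambda>i. G y ?N * e i) i"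
          by (rule Tcong[OF _ that]) (use z in \<open>auto simp: e_def le_Suc_eq\<close>)
        also have "\<dots> = G y ?N * p i" unfolding T_def householder_scale
          using TT[of p] Tp by (simp flip: T_def)
        finally show ?thesis .
      qed
      with p(2)[OF y \<open>G y ?N > 0\<close>] show False by blast
    qed
    have xN: "x \<in> sph ?N" using that sub by blast
    have "G x ?N \<noteq> 0" using nzG[OF xN] z by (auto simp: le_Suc_eq)
    then consider "G x ?N > 0" | "G (\<lambda>j. - x j) ?N > 0" using oddG[OF xN, of ?N] by fastforce
    then show False
    proof cases
      case 1
      then show False using pos[OF that] z by blast
    next
      case 2
      show False
        by (rule pos[OF sph_uminus[OF that] _ 2]) (use z oddG[OF xN] in auto)
    qed
  qed
  \<comment> \<open>The factor is even in \<open>x\<close>, so \<open>G'\<close> stays odd, and it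
    vanishes exactly on the equator.\<close>
  define G' where "G' = (\<lambda>x i. if i = ?N then (x ?N)\<^sup>2 * G x i else G x i)"
  have contG': "continuous_on (sph ?N) (\<lambda>x. G' x i)" if "i \<le> ?N" for i
    using contG[OF that] lip_continuous_on[OF lip_proj[of ?N ?N]] unfolding G'_def
    by (cases "i = ?N") (auto intro!: continuous_intros)
  have nzs: "\<exists>i\<le>?N. (1 - s) * G x i + s * G' x i \<noteq> 0" if s: "0 \<le> s" "s \<le> 1" and x: "x \<in> sph ?N" for s x
  proof (cases "\<exists>i\<le>n. G x i \<noteq> 0")
    case True
    then obtain i where "i \<le> n" "G x i \<noteq> 0" by blast
    then show ?thesis by (intro exI[of _ i]) (simp add: G'_def algebra_simps)
  next
    case False
    then have "G x ?N \<noteq> 0" using nzG[OF x] by (auto simp: le_Suc_eq)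
    have "x ?N \<noteq> 0"
    proof
      assume "x ?N = 0"
      then have "x \<in> sph n" using x by (auto simp: sph_iff) (metis Suc_lessI)
      then show False using eqG False by blast
    qed
    then have "(1 - s) + s * (x ?N)\<^sup>2 > 0"
      using s by (cases "s = 1") (auto intro: add_pos_nonneg)
    then have "((1 - s) + s * (x ?N)\<^sup>2) * G x ?N \<noteq> 0" using \<open>G x ?N \<noteq> 0\<close> by simp
    then show ?thesis by (intro exI[of _ ?N]) (simp add: G'_def algebra_simps)
  qed
  have nzG': "\<exists>i\<le>?N. G' x i \<noteq> 0" if "x \<in> sph ?N" for x using nzs[of 1 x] that by simp
  have cmT: "continuous_map (nsphere ?N) (nsphere ?N) T" and dT: "\<bar>Brouwer_degree2 ?N T\<bar> = 1"
    using homeomorphic_map_householder[of ?N w] p(1) Brouwer_degree2_homeomorphic_map homeomorphic_imp_continuous_map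
    by (auto simp: T_def w_def e_def sph_iff)
  \<comment> \<open>The reflection contributes a factor 1 or -1, so the parity for \<open>F\<close>
    can be read off from \<open>G\<close>.\<close>
  have "Brouwer_degree2 ?N (T \<circ> (\<lambda>x. nrm ?N (F x))) = Brouwer_degree2 ?N T * Brouwer_degree2 ?N (\<lambda>x. nrm ?N (F x))"
  proof (rule Brouwer_degree2_compose[OF _ cmT])
    show "continuous_map (nsphere ?N) (nsphere ?N) (\<lambda>x. nrm ?N (F x))"
      unfolding continuous_map_nsphere
      using lip_continuous_on[OF lip] nz by (auto intro!: continuous_on_nrm nrm_in_sph)
  qed
  also have "Brouwer_degree2 ?N (T \<circ> (\<lambda>x. nrm ?N (F x))) = Brouwer_degree2 ?N (\<lambda>x. nrm ?N (G x))"
  proof (rule Brouwer_degree2_eq)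
    fix x assume "x \<in> topspace (nsphere ?N)"
    then have x: "x \<in> sph ?N" by (simp add: topspace_nsphere)
    have norm: "L2_set (G x) {..?N} = L2_set (F x) {..?N}"
      by (simp add: L2_set_inner_upto G_def T_def inner_upto_householder_self)
    have "T (nrm ?N (F x)) i = nrm ?N (G x) i" for i
    proof (cases "i \<le> ?N")
      case True
      have "T (nrm ?N (F x)) i = T (\<lambda>i. (1 / L2_set (F x) {..?N}) * F x i) i"
        by (rule Tcong[OF _ True]) (simp add: nrm_def)
      then show ?thesis using True unfolding T_def householder_scale
        by (simp add: nrm_def norm) (simp add: G_def T_def)
    next
      case False
      then show ?thesis using p(1) by (simp add: T_def householder_def nrm_def w_def e_def sph_iff)
    qed
    then show "(T \<circ> (\<lambda>x. nrm ?N (F x))) x = nrm ?N (G x)" by (simp add: fun_eq_iff)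
  qed
  also have "Brouwer_degree2 ?N (\<lambda>x. nrm ?N (G x)) = Brouwer_degree2 ?N (\<lambda>x. nrm ?N (G' x))"
    by (rule homotopic_nrm[OF contG contG' nzs])
  finally have deg: "even (Brouwer_degree2 ?N (\<lambda>x. nrm ?N (F x))) \<longleftrightarrow> even (Brouwer_degree2 ?N (\<lambda>x. nrm ?N (G' x)))"
    using dT by (metis abs_eq_iff even_minus even_mult_iff odd_one abs_1)
  have restrict: "nrm ?N (G' x) = nrm n (G x)" if "x \<in> sph n" for x
  proof -
    have "x ?N = 0" using that by (simp add: sph_iff)
    then have G': "G' x ?N = 0" "\<And>i. i \<le> n \<Longrightarrow> G' x i = G x i" by (auto simp: G'_def)
    have "L2_set (G' x) {..?N} = L2_set (G x) {..n}"
      by (simp add: L2_set_def G')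
    then show ?thesis using G' by (auto simp: nrm_def le_Suc_eq fun_eq_iff)
  qed
  have "even (Brouwer_degree2 ?N (\<lambda>x. nrm ?N (G' x)) - Brouwer_degree2 (?N - Suc 0) (\<lambda>x. nrm ?N (G' x)))"
  proof (rule Borsuk_odd_mapping_degree_step)
    show "continuous_map (nsphere ?N) (nsphere ?N) (\<lambda>x. nrm ?N (G' x))"
      unfolding continuous_map_nsphere
      using contG' nzG' by (auto intro!: continuous_on_nrm nrm_in_sph)
    show "(\<lambda>x. nrm ?N (G' x)) \<in> topspace (nsphere (?N - Suc 0)) \<rightarrow> topspace (nsphere (?N - Suc 0))"
      using restrict eqG by (auto simp: topspace_nsphere intro!: nrm_in_sph)
    fix u assume "u \<in> topspace (nsphere ?N)"
    then have u: "u \<in> sph ?N" by (simp add: topspace_nsphere)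
    have G'u: "G' (\<lambda>j. - u j) i = - G' u i" if "i \<le> ?N" for i
      using oddG[OF u that] by (cases "i = ?N") (simp_all add: G'_def)
    have "L2_set (G' (\<lambda>j. - u j)) {..?N} = L2_set (\<lambda>i. - G' u i) {..?N}"
      by (rule L2_set_cong) (use G'u in auto)
    then have "nrm ?N (G' (\<lambda>j. - u j)) = nrm ?N (\<lambda>i. - G' u i)"
      using G'u by (auto simp: nrm_def fun_eq_iff)
    then show "((\<lambda>x. nrm ?N (G' x)) \<circ> (\<lambda>x i. - x i)) u = ((\<lambda>x i. - x i) \<circ> (\<lambda>x. nrm ?N (G' x))) u"
      by (simp add: nrm_uminus)
  qed
  moreover have "Brouwer_degree2 n (\<lambda>x. nrm ?N (G' x)) = Brouwer_degree2 n (\<lambda>x. nrm n (G x))"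
    by (rule Brouwer_degree2_eq) (simp add: topspace_nsphere restrict)
  moreover have "odd (Brouwer_degree2 n (\<lambda>x. nrm n (G x)))"
  proof (rule Suc.IH)
    show "lip n (\<lambda>x. G x i)" if "i \<le> n" for i using lipG[of i] that lip_mono[of ?N _ n] by simp
    show "G (\<lambda>j. - x j) i = - G x i" if "x \<in> sph n" "i \<le> n" for x i
      using oddG[of x i] that sub by auto
  qed (rule eqG)
  ultimately show ?case using deg by simp
qed

text \<open>Without a common zero, appending a zero coordinate and normalizing would give an odd
  self-map of the sphere that misses a pole; its degree would be both odd and 0.\<close>

theorem Borsuk_Ulam_lip:
  assumes lip: "\<And>i. i < n \<Longrightarrow> lip n (\<lambda>x. F x i)"
    and odd: "\<And>x i. x \<in> sph n \<Longrightarrow> i < n \<Longrightarrow> F (\<lambda>j. - x j) i = - F x i"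
  obtains x where "x \<in> sph n" "\<And>i. i < n \<Longrightarrow> F x i = 0"
proof (rule ccontr)
  assume "\<not> thesis"
  with that have nz: "\<exists>i<n. F x i \<noteq> 0" if "x \<in> sph n" for x using that by blast
  define G where "G = (\<lambda>x i. if i < n then F x i else 0)"
  have lipG: "lip n (\<lambda>x. G x i)" for i
    using lip[of i] by (cases "i < n") (auto simp: G_def lip_const)
  have nzG: "\<exists>i\<le>n. G x i \<noteq> 0" if "x \<in> sph n" for x
    using nz[OF that] by (auto simp: G_def intro: less_imp_le)
  have "odd (Brouwer_degree2 n (\<lambda>x. nrm n (G x)))"
    by (rule Borsuk_odd_mapping_degree_lip[OF lipG _ nzG]) (auto simp: G_def odd)
  moreover have "Brouwer_degree2 n (\<lambda>x. nrm n (G x)) = 0"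
  proof (rule Brouwer_degree2_nonsurjective)
    show "continuous_map (nsphere n) (nsphere n) (\<lambda>x. nrm n (G x))"
      unfolding continuous_map_nsphere
      using lip_continuous_on[OF lipG] nzG by (auto intro!: continuous_on_nrm nrm_in_sph)
    define e where "e = (\<lambda>i. if i = n then 1 else (0::real))"
    have "e \<in> sph n" by (simp add: sph_iff e_def if_distrib[of "\<lambda>t. t ^ 2"] cong: if_cong)
    moreover have "nrm n (G x) n \<noteq> e n" for x by (simp add: nrm_def G_def e_def)
    ultimately show "(\<lambda>x. nrm n (G x)) ` topspace (nsphere n) \<noteq> topspace (nsphere n)"
      unfolding topspace_nsphere by (metis (no_types, lifting) imageE)
  qed
  ultimately show False by simp
qed

subsection \<open>Rounding the multilinear extension\<close>

text \<open>The expectation of \<open>\<phi>\<close> on a random subset of \<open>M\<close> that contains each \<open>k\<close> independently with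
  probability \<open>x k\<close>.\<close>

definition mext :: "nat set \<Rightarrow> (nat set \<Rightarrow> real) \<Rightarrow> (nat \<Rightarrow> real) \<Rightarrow> real" where
  "mext M \<phi> x = (\<Sum>S\<in>Pow M. \<phi> S * (\<Prod>k\<in>M. if k \<in> S then x k else 1 - x k))"

text \<open>Conditioning on whether \<open>k\<close> is chosen; in particular the extension is
  affine in each coordinate.\<close>

lemma mext_insert:
  assumes "finite M" "k \<notin> M"
  shows "mext (insert k M) \<phi> x = x k * mext M (\<lambda>S. \<phi> (insert k S)) x + (1 - x k) * mext M \<phi> x"
proof -
  let ?w = "\<lambda>N S. \<Prod>j\<in>N. if j \<in> S then x j else 1 - x j"
  have "mext (insert k M) \<phi> x = (\<Sum>S\<in>Pow M. \<phi> S * ?w (insert k M) S) + (\<Sum>S\<in>insert k ` Pow M. \<phi> S * ?w (insert k M) S)"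
    unfolding mext_def Pow_insert by (rule sum.union_disjoint) (use assms in auto)
  also have "(\<Sum>S\<in>insert k ` Pow M. \<phi> S * ?w (insert k M) S)
      = (\<Sum>S\<in>Pow M. \<phi> (insert k S) * ?w (insert k M) (insert k S))"
    by (rule sum.reindex_cong[where l = "insert k"]) (use assms in \<open>auto intro!: inj_onI\<close>)
  also have "\<dots> = (\<Sum>S\<in>Pow M. x k * (\<phi> (insert k S) * ?w M S))"
  proof (intro sum.cong refl)
    fix S
    have "?w M (insert k S) = ?w M S" using assms by (intro prod.cong) auto
    then show "\<phi> (insert k S) * ?w (insert k M) (insert k S) = x k * (\<phi> (insert k S) * ?w M S)"
      using assms by simp
  qed
  also have "(\<Sum>S\<in>Pow M. \<phi> S * ?w (insert k M) S) = (\<Sum>S\<in>Pow M. (1 - x k) * (\<phi> S * ?w M S))"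
    using assms by (intro sum.cong refl) auto
  finally show ?thesis by (simp add: mext_def sum_distrib_left)
qed

lemma mext_one: "finite M \<Longrightarrow> mext M (\<lambda>_. 1) x = 1"
  by (induction M rule: finite_induct) (simp_all add: mext_insert, simp add: mext_def)

lemma mext_cong: "(\<And>k. k \<in> M \<Longrightarrow> x k = y k) \<Longrightarrow> mext M \<phi> x = mext M \<phi> y"
  unfolding mext_def by (intro sum.cong refl arg_cong2[where f = "(*)"] prod.cong) auto

text \<open>Probabilities \<open>1 - x k\<close> describe the complement of the random set.\<close>

lemma mext_reflect:
  assumes "\<And>S. S \<subseteq> M \<Longrightarrow> \<phi> (M - S) = - \<phi> S"
  shows "mext M \<phi> (\<lambda>k. 1 - x k) = - mext M \<phi> x"
proof -
  have "mext M \<phi> (\<lambda>k. 1 - x k) = (\<Sum>S\<in>Pow M. - (\<phi> S * (\<Prod>k\<in>M. if k \<in> S then x k else 1 - x k)))"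
    unfolding mext_def
  proof (rule sum.reindex_bij_witness[of _ "\<lambda>S. M - S" "\<lambda>S. M - S"])
    fix S assume S: "S \<in> Pow M"
    have "(\<Prod>k\<in>M. if k \<in> M - S then x k else 1 - x k) = (\<Prod>k\<in>M. if k \<in> S then 1 - x k else 1 - (1 - x k))"
      by (intro prod.cong) auto
    then show "- (\<phi> (M - S) * (\<Prod>k\<in>M. if k \<in> M - S then x k else 1 - x k))
        = \<phi> S * (\<Prod>k\<in>M. if k \<in> S then 1 - x k else 1 - (1 - x k))"
      using assms S by simp
  qed auto
  then show ?thesis by (simp add: mext_def sum_negf)
qed

lemma mext_diff_le:
  assumes "finite M" "\<And>S. S \<subseteq> M \<Longrightarrow> \<bar>\<phi> S - \<psi> S\<bar> \<le> L" "\<And>k. k \<in> M \<Longrightarrow> 0 \<le> x k \<and> x k \<le> 1"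
  shows "\<bar>mext M \<phi> x - mext M \<psi> x\<bar> \<le> L"
proof -
  let ?w = "\<lambda>S. \<Prod>j\<in>M. if j \<in> S then x j else 1 - x j"
  have w: "?w S \<ge> 0" for S using assms(3) by (intro prod_nonneg) auto
  have "\<bar>mext M \<phi> x - mext M \<psi> x\<bar> = \<bar>\<Sum>S\<in>Pow M. (\<phi> S - \<psi> S) * ?w S\<bar>"
    by (simp add: mext_def left_diff_distrib sum_subtractf)
  also have "\<dots> \<le> (\<Sum>S\<in>Pow M. \<bar>(\<phi> S - \<psi> S) * ?w S\<bar>)" by (rule sum_abs)
  also have "\<dots> \<le> (\<Sum>S\<in>Pow M. L * ?w S)"
  proof (rule sum_mono)
    fix S assume "S \<in> Pow M"
    then have "\<bar>\<phi> S - \<psi> S\<bar> * ?w S \<le> L * ?w S" using assms(2) w by (intro mult_right_mono) auto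
    then show "\<bar>(\<phi> S - \<psi> S) * ?w S\<bar> \<le> L * ?w S" unfolding abs_mult abs_of_nonneg[OF w] .
  qed
  also have "\<dots> = L * mext M (\<lambda>_. 1) x" by (simp add: mext_def sum_distrib_left)
  finally show ?thesis using mext_one[OF assms(1)] by simp
qed

lemma mext_vertex:
  assumes "finite M" "\<And>k. k \<in> M \<Longrightarrow> x k = 0 \<or> x k = 1"
  shows "mext M \<phi> x = \<phi> {k\<in>M. x k = 1}"
proof -
  let ?A = "{k\<in>M. x k = 1}"
  have "(\<Prod>k\<in>M. if k \<in> S then x k else 1 - x k) = (if S = ?A then 1 else 0)" if "S \<in> Pow M" for S
  proof (cases "S = ?A")
    case True
    have "(if k \<in> S then x k else 1 - x k) = 1" if "k \<in> M" for k
      using assms(2)[OF that] that True by auto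
    then show ?thesis using True by (simp add: prod.neutral)
  next
    case False
    then obtain k where "k \<in> M" "k \<in> S \<longleftrightarrow> x k \<noteq> 1" using \<open>S \<in> Pow M\<close> by blast
    then have "\<exists>k\<in>M. (if k \<in> S then x k else 1 - x k) = 0" using assms(2) by (intro bexI[of _ k]) auto
    then show ?thesis using False assms(1) by (simp add: prod_zero_iff)
  qed
  then have "mext M \<phi> x = (\<Sum>S\<in>Pow M. if S = ?A then \<phi> S else 0)"
    unfolding mext_def by (intro sum.cong) auto
  also have "\<dots> = \<phi> ?A" using assms(1) by (subst sum.delta) auto
  finally show ?thesis .
qed

text \<open>Made for variables of mean zero, whose linear term disappears in expectation. Up to 1
  the polynomial \<open>1 + u + u\<^sup>2\<close> separates the two sides; beyond 1 already
  \<open>u \<le> u\<^sup>2\<close> suffices.\<close>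

lemma exp_le_self_plus_exp_square: "exp (u::real) \<le> u + exp (u\<^sup>2)"
proof -
  have sq: "1 + u\<^sup>2 \<le> exp (u\<^sup>2)" by (rule exp_ge_add_one_self)
  consider "u < -1" | "-1 \<le> u" "u < 0" | "0 \<le> u" "u \<le> 1" | "1 < u" by linarith
  then show ?thesis
  proof cases
    case 1
    then have "exp u \<le> 1" by simp
    moreover have "0 \<le> u * (u + 1)" using 1 by (intro mult_nonpos_nonpos) auto
    moreover have "u * (u + 1) = u + u\<^sup>2" by (simp add: power2_eq_square algebra_simps)
    ultimately show ?thesis using sq by linarith
  next
    case 2
    \<comment> \<open>\<open>exp u\<close> is at most the reciprocal of the quadratic Taylor
      polynomial of \<open>exp v\<close>, and multiplying out shows that this reciprocal is at most
      \<open>1 - v + v\<^sup>2\<close>.\<close>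
    define v where "v = - u"
    have v: "0 < v" "v \<le> 1" using 2 by (auto simp: v_def)
    have "exp u * (1 + v + v\<^sup>2 / 2) \<le> exp u * exp v"
      using exp_lower_Taylor_quadratic[of v] v by (intro mult_left_mono) auto
    then have a: "exp u * (1 + v + v\<^sup>2 / 2) \<le> 1" by (simp add: v_def flip: exp_add)
    have "(1 - v + v\<^sup>2) * (1 + v + v\<^sup>2 / 2) = 1 + v\<^sup>2 / 2 + v ^ 3 / 2 + v ^ 4 / 2"
      by (simp add: power2_eq_square power3_eq_cube power4_eq_xxxx algebra_simps add_divide_distrib diff_divide_distrib)
    then have "1 \<le> (1 - v + v\<^sup>2) * (1 + v + v\<^sup>2 / 2)" using v by simp
    with a have "exp u * (1 + v + v\<^sup>2 / 2) \<le> (1 - v + v\<^sup>2) * (1 + v + v\<^sup>2 / 2)" by linarith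
    moreover have "0 < 1 + v + v\<^sup>2 / 2" using v by (simp add: add_pos_nonneg)
    ultimately have "exp u \<le> 1 - v + v\<^sup>2" using mult_le_cancel_right_pos by blast
    then show ?thesis using sq unfolding v_def power2_minus by linarith
  next
    case 3
    then have "exp u \<le> 1 + u + u\<^sup>2" by (intro exp_bound)
    then show ?thesis using sq by linarith
  next
    case 4
    then have "exp u \<le> exp (u\<^sup>2)" by (simp add: power2_eq_square)
    then show ?thesis using 4 by linarith
  qed
qed

text \<open>Hoeffding's lemma for a two-point distribution, with constant 1 instead of 1/8: the
  deviations \<open>u\<close> and \<open>v\<close> from the mean are at most
  \<open>\<bar>a - b\<bar>\<close> in size, and their weighted sum is 0.\<close>

lemma exp_two_point_le:
  fixes a b p :: real
  assumes "0 \<le> p" "p \<le> 1"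
  shows "p * exp a + (1 - p) * exp b \<le> exp ((a - b)\<^sup>2) * exp (p * a + (1 - p) * b)"
proof -
  define u v where "u = (1 - p) * (a - b)" and "v = - p * (a - b)"
  have uv: "a = (p * a + (1 - p) * b) + u" "b = (p * a + (1 - p) * b) + v"
    by (simp_all add: u_def v_def algebra_simps)
  have sq: "(c * (a - b))\<^sup>2 \<le> (a - b)\<^sup>2" if "\<bar>c\<bar> \<le> 1" for c
    using mult_right_mono[of "c\<^sup>2" 1 "(a - b)\<^sup>2"] that by (simp add: power_mult_distrib abs_square_le_1)
  have "exp (u\<^sup>2) \<le> exp ((a - b)\<^sup>2)" "exp (v\<^sup>2) \<le> exp ((a - b)\<^sup>2)"
    unfolding u_def v_def exp_le_cancel_iff using assms by (auto intro!: sq)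
  then have u: "exp u \<le> u + exp ((a - b)\<^sup>2)" and v: "exp v \<le> v + exp ((a - b)\<^sup>2)"
    using exp_le_self_plus_exp_square[of u] exp_le_self_plus_exp_square[of v] by linarith+
  have "p * exp u + (1 - p) * exp v \<le> p * (u + exp ((a - b)\<^sup>2)) + (1 - p) * (v + exp ((a - b)\<^sup>2))"
    using assms u v by (intro add_mono mult_left_mono) auto
  also have "\<dots> = exp ((a - b)\<^sup>2)" by (simp add: u_def v_def algebra_simps)
  finally have "(p * exp u + (1 - p) * exp v) * exp (p * a + (1 - p) * b)
      \<le> exp ((a - b)\<^sup>2) * exp (p * a + (1 - p) * b)" by (intro mult_right_mono) auto
  moreover have "exp a = exp u * exp (p * a + (1 - p) * b)" "exp b = exp v * exp (p * a + (1 - p) * b)"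
    using uv by (simp_all flip: exp_add add: add.commute)
  ultimately show ?thesis by (simp add: algebra_simps)
qed

lemma convex_bound_le_imp:
  fixes p u v c :: real
  assumes "0 \<le> p" "p \<le> 1" "p * u + (1 - p) * v \<le> c"
  shows "u \<le> c \<or> v \<le> c"
proof (rule ccontr)
  assume "\<not> ?thesis"
  then have "c < min u v" by auto
  have "p * min u v + (1 - p) * min u v \<le> p * u + (1 - p) * v"
    using assms by (intro add_mono mult_left_mono) auto
  moreover have "p * min u v + (1 - p) * min u v = min u v" by (simp flip: distrib_right)
  ultimately show False using assms(3) \<open>c < min u v\<close> by linarith
qed

text \<open>The bounded differences inequality, derandomized: fixing a fractional coordinate to the better of
  0 and 1 increases the potential by a factor of at most \<open>exp (L\<^sup>2)\<close>.\<close>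

lemma round_fractional_coordinates:
  fixes L :: real
  assumes M: "finite M" and T: "T \<subseteq> M"
    and x01: "\<And>k. k \<in> M \<Longrightarrow> 0 \<le> x k \<and> x k \<le> 1"
    and int: "\<And>k. k \<in> M - T \<Longrightarrow> x k = 0 \<or> x k = 1"
    and lip: "\<And>j k S. j \<in> J \<Longrightarrow> k \<in> M \<Longrightarrow> S \<subseteq> M \<Longrightarrow> \<bar>\<phi> j (insert k S) - \<phi> j S\<bar> \<le> L"
  shows "\<exists>A\<subseteq>M. (\<Sum>j\<in>J. exp (\<phi> j A)) \<le> exp (card T * L\<^sup>2) * (\<Sum>j\<in>J. exp (mext M (\<phi> j) x))"
proof -
  have "finite T" using M T finite_subset by blast
  then show ?thesis using T x01 int
  proof (induction T arbitrary: x rule: finite_induct)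
    case empty
    then show ?case
      using M by (intro exI[of _ "{k\<in>M. x k = 1}"]) (auto simp: mext_vertex)
  next
    case (insert k T)
    then have k: "k \<in> M" and p: "0 \<le> x k" "x k \<le> 1" by auto
    define N where "N = M - {k}"
    have N: "finite N" "k \<notin> N" "M = insert k N" using M k by (auto simp: N_def)
    let ?F = "\<lambda>x. \<Sum>j\<in>J. exp (mext M (\<phi> j) x)"
    define P where "P = (\<lambda>b. \<exists>A\<subseteq>M. (\<Sum>j\<in>J. exp (\<phi> j A)) \<le> exp (card T * L\<^sup>2) * ?F (x(k := b)))"
    have P: "P 0" "P 1"
      unfolding P_def using insert.prems k
      by (intro insert.IH; auto)+
    have step: "x k * exp (mext M (\<phi> j) (x(k := 1))) + (1 - x k) * exp (mext M (\<phi> j) (x(k := 0)))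
        \<le> exp (L\<^sup>2) * exp (mext M (\<phi> j) x)" if j: "j \<in> J" for j
    proof -
      \<comment> \<open>Along coordinate \<open>k\<close> the extension runs linearly from
        \<open>b\<close> to \<open>a\<close>, which differ by at most \<open>L\<close> because they
        average values that differ by one insertion.\<close>
      define a where "a = mext N (\<lambda>S. \<phi> j (insert k S)) x"
      define b where "b = mext N (\<phi> j) x"
      have upd: "mext N \<psi> (x(k := c)) = mext N \<psi> x" for \<psi> c
        using N by (intro mext_cong) auto
      have e: "mext M (\<phi> j) (x(k := 1)) = a" "mext M (\<phi> j) (x(k := 0)) = b"
        "mext M (\<phi> j) x = x k * a + (1 - x k) * b"
        using N by (simp_all add: mext_insert upd a_def b_def)
      have "\<bar>a - b\<bar> \<le> L" unfolding a_def b_def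
        using N lip[OF j k] insert.prems(2) by (intro mext_diff_le) auto
      then have "(a - b)\<^sup>2 \<le> L\<^sup>2" using abs_le_square_iff[of "a - b" L] by linarith
      then have "exp ((a - b)\<^sup>2) * exp (x k * a + (1 - x k) * b) \<le> exp (L\<^sup>2) * exp (x k * a + (1 - x k) * b)"
        by simp
      with exp_two_point_le[OF p, of a b] show ?thesis unfolding e by linarith
    qed
    have "x k * ?F (x(k := 1)) + (1 - x k) * ?F (x(k := 0)) \<le> exp (L\<^sup>2) * ?F x"
      unfolding sum_distrib_left sum.distrib[symmetric] by (rule sum_mono) (rule step)
    then have "?F (x(k := 1)) \<le> exp (L\<^sup>2) * ?F x \<or> ?F (x(k := 0)) \<le> exp (L\<^sup>2) * ?F x"
      by (rule convex_bound_le_imp[OF p])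
    then obtain b where b: "P b" "?F (x(k := b)) \<le> exp (L\<^sup>2) * ?F x"
      using P by blast
    then obtain A where "A \<subseteq> M" "(\<Sum>j\<in>J. exp (\<phi> j A)) \<le> exp (card T * L\<^sup>2) * ?F (x(k := b))"
      unfolding P_def by blast
    moreover have "exp (card T * L\<^sup>2) * ?F (x(k := b)) \<le> exp (card T * L\<^sup>2) * (exp (L\<^sup>2) * ?F x)"
      using b by (intro mult_left_mono) auto
    moreover have "exp (card T * L\<^sup>2) * (exp (L\<^sup>2) * ?F x) = exp (card (insert k T) * L\<^sup>2) * ?F x"
      using insert.hyps by (simp add: distrib_right exp_add)
    ultimately show ?case by (intro exI[of _ A]) auto
  qed
qed

lemma lip_mext:
  assumes "\<And>k. k \<in> M \<Longrightarrow> lip n (\<lambda>y. x y k)"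
  shows "lip n (\<lambda>y. mext M \<phi> (x y))"
proof -
  have "lip n (\<lambda>y. if k \<in> S then x y k else 1 - x y k)" if "k \<in> M" for k S
    using assms[OF that] lip_diff[OF lip_const assms[OF that]] by (cases "k \<in> S") simp_all
  then show ?thesis unfolding mext_def by (intro lip_sum lip_mult lip_prod lip_const)
qed

subsection \<open>Splitting the goods with few cuts\<close>

text \<open>Good \<open>k\<close> occupies the interval \<open>[k - 1, k]\<close>, and piece \<open>j\<close>, of length \<open>m y\<^sub>j\<^sup>2\<close>, goes to the side
  given by the sign of \<open>y\<^sub>j\<close>. The signed amount of good \<open>k\<close> handed out in this way is \<open>share\<close>; it is
  written with \<open>max\<close> instead of \<open>sgn\<close> because this form is visibly Lipschitz and odd in \<open>y\<close>.\<close>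

definition clamp :: "nat \<Rightarrow> real \<Rightarrow> real" where
  "clamp k t = max 0 (min 1 (t - (real k - 1)))"

definition cut :: "nat \<Rightarrow> (nat \<Rightarrow> real) \<Rightarrow> nat \<Rightarrow> real" where
  "cut m y j = real m * (\<Sum>l<j. (y l)\<^sup>2)"

definition share :: "nat \<Rightarrow> nat \<Rightarrow> (nat \<Rightarrow> real) \<Rightarrow> nat \<Rightarrow> real" where
  "share m n y k = (\<Sum>j\<le>n. clamp k (cut m y j + real m * (max (y j) 0)\<^sup>2)
                         - clamp k (cut m y j + real m * (max (- y j) 0)\<^sup>2))"

lemma clamp_lipschitz: "\<bar>clamp k s - clamp k t\<bar> \<le> \<bar>s - t\<bar>"
  unfolding clamp_def by linarith

lemma clamp_mono: "s \<le> t \<Longrightarrow> clamp k s \<le> clamp k t"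
  unfolding clamp_def by linarith

lemma lip_share: "lip n (\<lambda>y. share m n y k)"
proof -
  have pos: "lip n (\<lambda>y. max (h y) 0)" if "lip n h" for h
    using that by (rule lip_compose) linarith
  have "lip n (\<lambda>y. clamp k (cut m y j + real m * (max (h y) 0)\<^sup>2))" if "lip n h" for h j
    unfolding cut_def
    by (rule lip_compose[OF _ clamp_lipschitz])
      (intro lip_add lip_mult lip_const lip_power lip_sum lip_proj pos that)
  then show ?thesis unfolding share_def
    by (intro lip_sum lip_diff) (auto intro: lip_proj lip_uminus)
qed

lemma share_uminus: "share m n (\<lambda>j. - y j) k = - share m n y k"
  unfolding share_def cut_def by (simp flip: sum_negf)

section \<open>How the cuts divide a single good\<close>

lemma cut_0: "cut m y 0 = 0"
  by (simp add: cut_def)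

lemma cut_last: "y \<in> sph n \<Longrightarrow> cut m y (Suc n) = m"
  by (simp add: cut_def sph_iff lessThan_Suc_atMost)

lemma cut_le_Suc: "cut m y j \<le> cut m y (Suc j)"
  by (simp add: cut_def distrib_left)

text \<open>The sign of \<open>y j\<close> selects which of the two \<open>max\<close> terms
  survives; the difference of clamps is the length of good \<open>k\<close> inside piece
  \<open>j\<close>.\<close>

lemma share_sgn:
  "share m n y k = (\<Sum>j\<le>n. sgn (y j) * (clamp k (cut m y (Suc j)) - clamp k (cut m y j)))"
  unfolding share_def
proof (intro sum.cong refl)
  fix j
  have c: "cut m y (Suc j) = cut m y j + real m * (y j)\<^sup>2" by (simp add: cut_def distrib_left)
  show "clamp k (cut m y j + real m * (max (y j) 0)\<^sup>2) - clamp k (cut m y j + real m * (max (- y j) 0)\<^sup>2)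
      = sgn (y j) * (clamp k (cut m y (Suc j)) - clamp k (cut m y j))"
    by (cases "y j" "0::real" rule: linorder_cases) (simp_all add: c max_def)
qed

lemma clamp_ends:
  assumes "y \<in> sph n" "k \<in> {1..m}"
  shows "clamp k (cut m y 0) = 0" "clamp k (cut m y (Suc n)) = 1"
  using assms by (auto simp: clamp_def cut_0 cut_last)

text \<open>Without the signs the sum telescopes to the whole length 1 of the good.\<close>

lemma abs_share_le_1:
  assumes "y \<in> sph n" "k \<in> {1..m}"
  shows "\<bar>share m n y k\<bar> \<le> 1"
proof -
  have "\<bar>share m n y k\<bar> \<le> (\<Sum>j\<le>n. \<bar>sgn (y j) * (clamp k (cut m y (Suc j)) - clamp k (cut m y j))\<bar>)"
    unfolding share_sgn by (rule sum_abs)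
  also have "\<dots> \<le> (\<Sum>j\<le>n. clamp k (cut m y (Suc j)) - clamp k (cut m y j))"
    using clamp_mono[OF cut_le_Suc, of k m y]
    by (intro sum_mono) (simp add: abs_mult abs_sgn_eq)
  also have "\<dots> = clamp k (cut m y (Suc n)) - clamp k (cut m y 0)"
    by (induction n) simp_all
  finally show ?thesis using clamp_ends[OF assms] by simp
qed

text \<open>For a good with no cut in its interior: it lies within one piece, and its share is the
  sign of that piece. The signs are constrained at the jump only, since a piece of length zero has
  sign 0.\<close>

lemma abs_sum_single_jump:
  fixes b s :: "nat \<Rightarrow> real"
  assumes b01: "\<And>j. j \<le> Suc n \<Longrightarrow> b j = 0 \<or> b j = 1" and mono: "\<And>j. b j \<le> b (Suc j)"
    and ends: "b 0 = 0" "b (Suc n) = 1"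
    and s: "\<And>j. b j \<noteq> b (Suc j) \<Longrightarrow> \<bar>s j\<bar> = 1"
  shows "\<bar>\<Sum>j\<le>n. s j * (b (Suc j) - b j)\<bar> = 1"
proof -
  define j0 where "j0 = (LEAST j. b (Suc j) = 1)"
  have j0: "b (Suc j0) = 1" "j0 \<le> n" unfolding j0_def using ends(2) by (auto intro: LeastI Least_le)
  have less: "b (Suc j) \<noteq> 1" if "j < j0" for j using that not_less_Least unfolding j0_def by blast
  have incr: "b i \<le> b j" if "i \<le> j" for i j using lift_Suc_mono_le[of b, OF mono that] .
  have z: "b j = 0" if "j \<le> j0" for j
    using that ends(1) less[of "j - 1"] b01[of j] j0(2) by (cases j) auto
  have o: "b j = 1" if "j0 < j" "j \<le> Suc n" for j
    using incr[of "Suc j0" j] that j0(1) b01[of j] by auto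
  have "(\<Sum>j\<le>n. s j * (b (Suc j) - b j)) = (\<Sum>j\<in>{j0}. s j * (b (Suc j) - b j))"
  proof (rule sum.mono_neutral_right)
    show "\<forall>j\<in>{..n} - {j0}. s j * (b (Suc j) - b j) = 0"
    proof
      fix j assume "j \<in> {..n} - {j0}"
      then consider "Suc j \<le> j0" | "j0 < j" "j \<le> n" by fastforce
      then show "s j * (b (Suc j) - b j) = 0" by cases (auto simp: z o)
    qed
  qed (use j0 in auto)
  also have "\<dots> = s j0" using j0 z[of j0] by simp
  finally show ?thesis using s[of j0] j0 z[of j0] by simp
qed

text \<open>A good with a fractional share has a cut strictly inside its interval and is recovered
  as the ceiling of that cut. The cuts with index 0 and \<open>n + 1\<close> are the ends 0 and
  \<open>m\<close>, which leaves \<open>n\<close> candidates.\<close>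

lemma card_fractional_share_le:
  assumes y: "y \<in> sph n"
  shows "card {k \<in> {1..m}. \<bar>share m n y k\<bar> \<noteq> 1} \<le> n"
proof -
  let ?T = "{k \<in> {1..m}. \<bar>share m n y k\<bar> \<noteq> 1}"
  have "?T \<subseteq> (\<lambda>j. nat \<lceil>cut m y j\<rceil>) ` {1..n}"
  proof
    fix k assume k: "k \<in> ?T"
    have "\<exists>j\<le>Suc n. real k - 1 < cut m y j \<and> cut m y j < real k"
    proof (rule ccontr)
      assume none: "\<not> ?thesis"
      have "clamp k (cut m y j) = 0 \<or> clamp k (cut m y j) = 1" if "j \<le> Suc n" for j
        using none that unfolding clamp_def by force
      moreover have "\<bar>sgn (y j)\<bar> = 1" if "clamp k (cut m y j) \<noteq> clamp k (cut m y (Suc j))" for j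
        using that by (auto simp: cut_def sgn_if)
      ultimately have "\<bar>share m n y k\<bar> = 1"
        unfolding share_sgn using clamp_ends[OF y, of k] k clamp_mono[OF cut_le_Suc]
        by (intro abs_sum_single_jump) auto
      with k show False by simp
    qed
    then obtain j where j: "j \<le> Suc n" "real k - 1 < cut m y j" "cut m y j < real k" by blast
    have "cut m y j \<noteq> cut m y 0" using j k by (auto simp: cut_0)
    moreover have "cut m y j \<noteq> cut m y (Suc n)" using j k cut_last[OF y, of m] by auto
    ultimately have "j \<in> {1..n}" using j(1) by (cases "j = Suc n") (auto simp: Suc_le_eq intro: gr0I)
    moreover have "\<lceil>cut m y j\<rceil> = int k" using j by linarith
    ultimately show "k \<in> (\<lambda>j. nat \<lceil>cut m y j\<rceil>) ` {1..n}" by (intro image_eqI[of _ _ j]) auto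
  qed
  then have "card ?T \<le> card ((\<lambda>j. nat \<lceil>cut m y j\<rceil>) ` {1..n})" by (intro card_mono) auto
  also have "\<dots> \<le> n" using card_image_le[of "{1..n}"] by fastforce
  finally show ?thesis .
qed

subsection \<open>Discrepancy of odd Lipschitz set functions\<close>

text \<open>The free parameter \<open>r\<close> scales the exponential potential. At a common zero
  of the extensions the potential of the \<open>2 * n\<close> signed functions is
  \<open>2 * n\<close>, the source of the logarithm; rounding contributes the other term.\<close>

theorem odd_lipschitz_discrepancy:
  fixes \<phi> :: "nat \<Rightarrow> nat set \<Rightarrow> real"
  assumes odd: "\<And>i S. i < n \<Longrightarrow> S \<subseteq> {1..m} \<Longrightarrow> \<phi> i ({1..m} - S) = - \<phi> i S"
    and lip: "\<And>i k S. i < n \<Longrightarrow> k \<in> {1..m} \<Longrightarrow> S \<subseteq> {1..m} \<Longrightarrow> \<bar>\<phi> i (insert k S) - \<phi> i S\<bar> \<le> L"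
    and lam: "0 < r"
  shows "\<exists>A\<subseteq>{1..m}. \<forall>i<n. \<bar>\<phi> i A\<bar> \<le> ln (2 * real n) / r + real n * r * L\<^sup>2"
proof -
  let ?M = "{1..m}"
  \<comment> \<open>Signed shares become probabilities, and the antipode becomes
    \<open>1 - X\<close>, which \<open>mext_reflect\<close> turns into oddness.\<close>
  define X where "X = (\<lambda>y k. (1 + share m n y k) / 2)"
  have X_uminus: "X (\<lambda>j. - y j) = (\<lambda>k. 1 - X y k)" for y
    by (simp add: X_def share_uminus fun_eq_iff field_simps)
  have lip_F: "lip n (\<lambda>y. mext ?M (\<phi> i) (X y))" for i
    unfolding X_def divide_inverse
    by (intro lip_mext lip_mult lip_add lip_const lip_share)
  have odd_F: "mext ?M (\<phi> i) (X (\<lambda>j. - y j)) = - mext ?M (\<phi> i) (X y)" if "i < n" for y i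
    unfolding X_uminus using odd[OF that] by (rule mext_reflect)
  obtain y where y: "y \<in> sph n" "\<And>i. i < n \<Longrightarrow> mext ?M (\<phi> i) (X y) = 0"
    using Borsuk_Ulam_lip[where F = "\<lambda>y i. mext ?M (\<phi> i) (X y)", OF lip_F odd_F] by blast
  define T where "T = {k \<in> ?M. \<bar>share m n y k\<bar> \<noteq> 1}"
  \<comment> \<open>Both signs occur, so that one-sided exponential bounds control absolute
    values.\<close>
  define \<psi> where "\<psi> = (\<lambda>(i, c) S. c * r * \<phi> i S)"
  define J where "J = {..<n} \<times> {1, -1 :: real}"
  have cardJ: "card J = 2 * n" "finite J" by (simp_all add: J_def)
  have "\<exists>A\<subseteq>?M. (\<Sum>j\<in>J. exp (\<psi> j A)) \<le> exp (card T * (r * L)\<^sup>2) * (\<Sum>j\<in>J. exp (mext ?M (\<psi> j) (X y)))"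
  proof (rule round_fractional_coordinates)
    show "T \<subseteq> ?M" by (auto simp: T_def)
    show "0 \<le> X y k \<and> X y k \<le> 1" if "k \<in> ?M" for k
      using abs_share_le_1[OF y(1) that] by (auto simp: X_def)
    show "X y k = 0 \<or> X y k = 1" if "k \<in> ?M - T" for k
      using that by (auto simp: T_def X_def abs_if split: if_splits)
    show "\<bar>\<psi> j (insert k S) - \<psi> j S\<bar> \<le> r * L" if j: "j \<in> J" and k: "k \<in> ?M" "S \<subseteq> ?M" for j k S
    proof -
      obtain i c where ic: "j = (i, c)" "i < n" "\<bar>c\<bar> = 1" using j by (auto simp: J_def)
      have "\<psi> j (insert k S) - \<psi> j S = c * (r * (\<phi> i (insert k S) - \<phi> i S))"
        by (simp add: \<psi>_def ic algebra_simps)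
      then have "\<bar>\<psi> j (insert k S) - \<psi> j S\<bar> = r * \<bar>\<phi> i (insert k S) - \<phi> i S\<bar>"
        using ic lam by (simp add: abs_mult)
      then show ?thesis using lip[OF ic(2) k] lam by simp
    qed
  qed simp
  moreover have "mext ?M (\<psi> j) (X y) = 0" if j: "j \<in> J" for j
  proof -
    obtain i c where ic: "j = (i, c)" "i < n" using j unfolding J_def by blast
    have "mext ?M (\<psi> j) (X y) = c * r * mext ?M (\<phi> i) (X y)"
      by (simp add: mext_def \<psi>_def ic sum_distrib_left mult.assoc)
    then show ?thesis using y(2)[OF ic(2)] by simp
  qed
  ultimately obtain A where A: "A \<subseteq> ?M" "(\<Sum>j\<in>J. exp (\<psi> j A)) \<le> exp (card T * (r * L)\<^sup>2) * (2 * real n)"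
    using cardJ by auto
  have "card T \<le> n" unfolding T_def by (rule card_fractional_share_le[OF y(1)])
  have "\<bar>\<phi> i A\<bar> \<le> ln (2 * real n) / r + real n * r * L\<^sup>2" if i: "i < n" for i
  proof -
    have bound: "exp (\<psi> j A) \<le> exp (real n * (r * L)\<^sup>2) * (2 * real n)" if "j \<in> J" for j
    proof -
      have "exp (\<psi> j A) \<le> (\<Sum>j\<in>J. exp (\<psi> j A))" using that cardJ by (intro member_le_sum) auto
      also note A(2)
      also have "exp (card T * (r * L)\<^sup>2) * (2 * real n) \<le> exp (real n * (r * L)\<^sup>2) * (2 * real n)"
        using \<open>card T \<le> n\<close> by (intro mult_right_mono) (auto intro: mult_right_mono)
      finally show ?thesis .
    qed
    have "\<psi> j A \<le> real n * (r * L)\<^sup>2 + ln (2 * real n)" if "j \<in> J" for j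
    proof -
      have "\<psi> j A = ln (exp (\<psi> j A))" by simp
      also have "\<dots> \<le> ln (exp (real n * (r * L)\<^sup>2) * (2 * real n))"
        using bound[OF that] i by (subst ln_le_cancel_iff) auto
      also have "\<dots> = real n * (r * L)\<^sup>2 + ln (2 * real n)" using i by (subst ln_mult_pos) auto
      finally show ?thesis .
    qed
    from this[of "(i, 1)"] this[of "(i, -1)"] have "r * \<bar>\<phi> i A\<bar> \<le> real n * (r * L)\<^sup>2 + ln (2 * real n)"
      using i by (auto simp: J_def \<psi>_def abs_if)
    then have "\<bar>\<phi> i A\<bar> \<le> (real n * (r * L)\<^sup>2 + ln (2 * real n)) / r"
      using lam by (simp add: pos_le_divide_eq mult.commute)
    also have "\<dots> = ln (2 * real n) / r + real n * r * L\<^sup>2"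
      using lam by (simp add: field_simps power2_eq_square)
    finally show ?thesis .
  qed
  with A(1) show ?thesis by blast
qed

subsection \<open>Envy as a Lipschitz set function\<close>

text \<open>The inserted 0 clips the value at distance \<open>c\<close> and also covers an empty
  \<open>P\<close>.\<close>

definition proximity :: "nat \<Rightarrow> nat set set \<Rightarrow> nat set \<Rightarrow> real" where
  "proximity c P S = Max (insert 0 ((\<lambda>T. real c - real (card (sym_diff S T))) ` P))"

lemma Max_insert_image_le:
  assumes "finite P" "\<And>T. T \<in> P \<Longrightarrow> f T \<le> g T + (1::real)"
  shows "Max (insert 0 (f ` P)) \<le> Max (insert 0 (g ` P)) + 1"
proof (rule Max.boundedI)
  have fin: "finite (insert 0 (g ` P))" using assms(1) by simp
  have "0 \<le> Max (insert 0 (g ` P))" using fin by (intro Max_ge) auto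
  moreover have "f T \<le> Max (insert 0 (g ` P)) + 1" if "T \<in> P" for T
  proof -
    have "g T \<le> Max (insert 0 (g ` P))" using fin that by (intro Max_ge) auto
    then show ?thesis using assms(2)[OF that] by linarith
  qed
  ultimately show "a \<le> Max (insert 0 (g ` P)) + 1" if "a \<in> insert 0 (f ` P)" for a using that by auto
qed (use assms in auto)

lemma proximity_insert:
  assumes "finite P" "finite S" "\<And>T. T \<in> P \<Longrightarrow> finite T"
  shows "\<bar>proximity c P (insert k S) - proximity c P S\<bar> \<le> 1"
proof -
  have "card (sym_diff (insert k S) T) \<le> Suc (card (sym_diff S T))"
    "card (sym_diff S T) \<le> Suc (card (sym_diff (insert k S) T))" if "T \<in> P" for T
  proof -
    have "card (sym_diff (insert k S) T) \<le> card (insert k (sym_diff S T))"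
      "card (sym_diff S T) \<le> card (insert k (sym_diff (insert k S) T))"
      using assms that by (auto intro!: card_mono)
    moreover have "card (insert k B) \<le> Suc (card B)" for B :: "nat set"
      by (rule card_insert_le_m1) simp_all
    ultimately show "card (sym_diff (insert k S) T) \<le> Suc (card (sym_diff S T))"
      "card (sym_diff S T) \<le> Suc (card (sym_diff (insert k S) T))" using le_trans by blast+
  qed
  then have "proximity c P (insert k S) \<le> proximity c P S + 1" "proximity c P S \<le> proximity c P (insert k S) + 1"
    unfolding proximity_def by (intro Max_insert_image_le[OF assms(1)]; fastforce)+
  then show ?thesis by linarith
qed

lemma proximity_mem:
  assumes "finite P" "S \<in> P" shows "real c \<le> proximity c P S"
  unfolding proximity_def using assms by (intro Max_ge) (auto intro!: image_eqI[of _ _ S])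

lemma proximity_far:
  assumes "finite P" "\<And>T. T \<in> P \<Longrightarrow> c \<le> card (sym_diff S T)"
  shows "proximity c P S \<le> 0"
  unfolding proximity_def using assms by (intro Max.boundedI) auto

text \<open>The bundles \<open>S\<close> that cause envy in the owner of \<open>M - S\<close> whichever \<open>c\<close> goods are removed. They are
  at distance at least \<open>c\<close> from the bundles whose owner is envious, hence the two proximities in
  \<open>envy\<close> do not interfere.\<close>

definition envied :: "nat \<Rightarrow> nat set \<Rightarrow> (nat set \<Rightarrow> real) \<Rightarrow> nat set set" where
  "envied c M v = {S. S \<subseteq> M \<and> (\<forall>R\<subseteq>S. card R \<le> c \<longrightarrow> v (M - S) < v (S - R))}"

text \<open>The distance is at least the size of \<open>S \<inter> T\<close>. If that were below
  \<open>c\<close>, removing \<open>S \<inter> T\<close> from both bundles would give, with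
  monotonicity, the cycle \<open>v (M - S) < v (S - T) \<le> v (M - T) < v (T - S) \<le> v (M -
  S)\<close>.\<close>

lemma envied_far_from_complements:
  assumes M: "finite M" and mono: "mono_on (Pow M) v"
    and S: "S \<in> envied c M v" and T: "T \<in> envied c M v"
  shows "c \<le> card (sym_diff S (M - T))"
proof (rule ccontr)
  assume small: "\<not> ?thesis"
  have sub: "S \<subseteq> M" "T \<subseteq> M" using S T by (auto simp: envied_def)
  have "card (S \<inter> T) \<le> card (sym_diff S (M - T))"
    using sub M finite_subset[OF sub(1)] by (intro card_mono) auto
  then have card: "card (S \<inter> T) \<le> c" using small by linarith
  have "v (M - S) < v (S - S \<inter> T)" "v (M - T) < v (T - S \<inter> T)"
    using S T card by (auto simp: envied_def)
  moreover have "v (S - S \<inter> T) \<le> v (M - T)" "v (T - S \<inter> T) \<le> v (M - S)"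
    using sub by (auto intro!: mono_onD[OF mono])
  ultimately show False by linarith
qed

definition envy :: "nat \<Rightarrow> nat set \<Rightarrow> (nat set \<Rightarrow> real) \<Rightarrow> nat set \<Rightarrow> real" where
  "envy c M v S = proximity c (envied c M v) S - proximity c (envied c M v) (M - S)"

lemma finite_envied: "finite M \<Longrightarrow> finite (envied c M v)"
  by (rule finite_subset[of _ "Pow M"]) (auto simp: envied_def)

lemma envy_complement: "S \<subseteq> M \<Longrightarrow> envy c M v (M - S) = - envy c M v S"
  by (simp add: envy_def double_diff)

lemma envy_insert:
  assumes M: "finite M" and k: "k \<in> M" and S: "S \<subseteq> M"
  shows "\<bar>envy c M v (insert k S) - envy c M v S\<bar> \<le> 2"
proof -
  let ?P = "envied c M v"
  have fin: "finite T" if "T \<in> ?P" for T using that finite_subset[OF _ M] by (auto simp: envied_def)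
  have "\<bar>proximity c ?P (insert k S) - proximity c ?P S\<bar> \<le> 1"
    by (rule proximity_insert[OF finite_envied[OF M] finite_subset[OF S M] fin])
  moreover have "\<bar>proximity c ?P (M - S) - proximity c ?P (M - insert k S)\<bar> \<le> 1"
  proof (cases "k \<in> S")
    case True
    then show ?thesis by (simp add: insert_absorb)
  next
    case False
    then have "M - S = insert k (M - insert k S)" using k by blast
    then show ?thesis
      using M by (metis proximity_insert finite_envied fin finite_Diff)
  qed
  ultimately show ?thesis unfolding envy_def by linarith
qed

text \<open>If \<open>S\<close> were envied, its own proximity would be at least \<open>c\<close>,
  while that of \<open>M - S\<close>, far from all envied bundles, would be clipped to 0; so
  \<open>envy\<close> would reach \<open>c\<close>.\<close>

lemma no_envy_if_envy_small:
  assumes M: "finite M" and mono: "mono_on (Pow M) v" and S: "S \<subseteq> M" and small: "\<bar>envy c M v S\<bar> < c"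
  shows "no_envy_up_to c v (M - S) S"
proof -
  have "S \<notin> envied c M v"
  proof
    assume "S \<in> envied c M v"
    moreover have "c \<le> card (sym_diff (M - S) T)" if "T \<in> envied c M v" for T
    proof -
      have "T \<subseteq> M" using that by (auto simp: envied_def)
      then have "sym_diff (M - S) T = sym_diff T (M - S)" by blast
      then show ?thesis using envied_far_from_complements[OF M mono that \<open>S \<in> envied c M v\<close>] by simp
    qed
    ultimately have "real c \<le> proximity c (envied c M v) S" "proximity c (envied c M v) (M - S) \<le> 0"
      by (auto intro: proximity_mem proximity_far finite_envied M)
    then have "real c \<le> envy c M v S" unfolding envy_def by linarith
    with small show False by linarith
  qed
  then obtain R where "R \<subseteq> S" "card R \<le> c" "v (S - R) \<le> v (M - S)"
    using S by (auto simp: envied_def not_less)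
  then show ?thesis using M S unfolding no_envy_up_to_def by (meson finite_subset)
qed

theorem corollary11:
  shows "\<exists>C::real. C > 0 \<and>
    (\<forall>(n::nat) (m::nat) (u :: nat \<Rightarrow> nat set \<Rightarrow> real) (G\<^sub>1 :: nat set) (G\<^sub>2 :: nat set).
       n \<ge> 2 \<longrightarrow> m > 0 \<longrightarrow>
       (\<forall>i\<in>{1..n}. mono_on (Pow {1..m}) (u i)) \<longrightarrow>
       G\<^sub>1 \<union> G\<^sub>2 = {1..n} \<longrightarrow> G\<^sub>1 \<inter> G\<^sub>2 = {} \<longrightarrow>
       (\<exists>(c::nat) A\<^sub>1 A\<^sub>2. real c \<le> C * sqrt (real n * ln (real n)) \<and>
          allocation m A\<^sub>1 A\<^sub>2 \<and> envy_free_up_to c u G\<^sub>1 G\<^sub>2 A\<^sub>1 A\<^sub>2))"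
proof (rule exI[of _ 8], intro conjI allI impI)
  fix n m :: nat and u :: "nat \<Rightarrow> nat set \<Rightarrow> real" and G\<^sub>1 G\<^sub>2 :: "nat set"
  assume n: "n \<ge> 2" and mono: "\<forall>i\<in>{1..n}. mono_on (Pow {1..m}) (u i)" and G: "G\<^sub>1 \<union> G\<^sub>2 = {1..n}"
  let ?M = "{1..m}"
  define l where "l = ln (real n)"
  define s where "s = sqrt (real n * l)"
  \<comment> \<open>Strictly above \<open>6 * s\<close>, the discrepancy bound obtained below;
    \<open>s \<ge> 1\<close> absorbs the rounding into the constant 8.\<close>
  define c where "c = Suc (nat \<lfloor>6 * s\<rfloor>)"
  have "ln 2 \<le> l" unfolding l_def using n by simp
  moreover have "1 - 1 / 2 \<le> ln (2::real)" using ln_le_minus_one[of "1 / 2 :: real"] by (simp add: ln_div)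
  ultimately have l: "1 / 2 \<le> l" by linarith
  have "1 \<le> 2 * (1 / 2 :: real)" by simp
  also have "\<dots> \<le> real n * l" using n l by (intro mult_mono) auto
  finally have s1: "1 \<le> s" unfolding s_def by simp
  \<comment> \<open>This balances the two terms of the bound: they become at most
    \<open>2 * s\<close> and exactly \<open>4 * s\<close>.\<close>
  define lam where "lam = s / n"
  have lam: "0 < lam" using s1 n by (simp add: lam_def)
  have s2: "s * s = real n * l" using n l by (simp add: s_def)
  \<comment> \<open>Agents are numbered from 1, the functions in the discrepancy theorem from
    0.\<close>
  have "\<exists>A\<subseteq>?M. \<forall>i<n. \<bar>envy c ?M (u (Suc i)) A\<bar> \<le> ln (2 * real n) / lam + real n * lam * 2\<^sup>2"
    by (rule odd_lipschitz_discrepancy) (auto intro!: envy_complement envy_insert lam)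
  then obtain A where A: "A \<subseteq> ?M"
    "\<And>i. i < n \<Longrightarrow> \<bar>envy c ?M (u (Suc i)) A\<bar> \<le> ln (2 * real n) / lam + real n * lam * 2\<^sup>2"
    by blast
  have "ln (2 * real n) / lam \<le> 2 * s"
  proof -
    have "ln (2 * real n) \<le> 2 * l" using n \<open>ln 2 \<le> l\<close> by (simp add: ln_mult_pos l_def)
    also have "\<dots> = 2 * s * lam" using s2 n by (simp add: lam_def field_simps)
    finally show ?thesis using lam by (simp add: pos_divide_le_eq)
  qed
  moreover have "real n * lam * 2\<^sup>2 = 4 * s" using n by (simp add: lam_def)
  moreover have "6 * s < real c" unfolding c_def by linarith
  ultimately have small: "\<bar>envy c ?M (u i) A\<bar> < c" if "i \<in> {1..n}" for i
    using A(2)[of "i - 1"] that by force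
  have "no_envy_up_to c (u i) (?M - A) A" "no_envy_up_to c (u i) A (?M - A)" if i: "i \<in> {1..n}" for i
  proof -
    show "no_envy_up_to c (u i) (?M - A) A"
      using mono i A(1) small[OF i] by (intro no_envy_if_envy_small) auto
    \<comment> \<open>By oddness the same bound holds for the complement, so agent \<open>i\<close>
      accepts either side.\<close>
    have "\<bar>envy c ?M (u i) (?M - A)\<bar> < c" using small[OF i] A(1) by (simp add: envy_complement)
    then have "no_envy_up_to c (u i) (?M - (?M - A)) (?M - A)"
      using mono i by (intro no_envy_if_envy_small) auto
    then show "no_envy_up_to c (u i) A (?M - A)" using A(1) by (simp add: double_diff)
  qed
  then have "envy_free_up_to c u G\<^sub>1 G\<^sub>2 A (?M - A)"
    unfolding envy_free_up_to_def G[symmetric] by blast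
  moreover have "allocation m A (?M - A)" using A(1) by (auto simp: allocation_def)
  moreover have "real c \<le> 8 * sqrt (real n * ln (real n))"
  proof -
    have "real c \<le> 6 * s + 1" unfolding c_def using s1 by simp
    then show ?thesis using s1 unfolding s_def l_def by linarith
  qed
  ultimately show "\<exists>(c::nat) A\<^sub>1 A\<^sub>2. real c \<le> 8 * sqrt (real n * ln (real n)) \<and>
      allocation m A\<^sub>1 A\<^sub>2 \<and> envy_free_up_to c u G\<^sub>1 G\<^sub>2 A\<^sub>1 A\<^sub>2" by blast
qed simp

end
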